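(* Any two reduced precovers of $G=G_1\ast_A G_2$ determining the same subgroup are isomorphic; that is, if $(\Gamma_1,v_1)$ and $(\Gamma_2,v_2)$ are reduced precovers of $G$ with $Lab(\Gamma_1,v_1)=Lab(\Gamma_2,v_2)$, then they are isomorphic as pointed labelled graphs.
   Context: Amalgam. $G_1=gp\langle X_1|R_1\rangle$, $G_2=gp\langle X_2|R_2\rangle$ are finitely presented groups given by fixed finite presentations with $X_1^{\pm}\cap X_2^{\pm}=\emptyset$; $A$ is a group with monomorphisms $\phi_i:A\to G_i$ ($i=1,2$); $G=G_1\ast_A G_2=gp\langle X_1,X_2\mid R_1,R_2,\phi_1(A)=\phi_2(A)\rangle$ is given by this finite presentation, $X=X_1\cup X_2$. $A$ is identified with its images in $G_1$, $G_2$ and $G$. Graphs. A graph $\Gamma$ has vertices $V(\Gamma)$, directed edges $E(\Gamma)$, an involution $e\mapsto\overline e\neq e$ on edges, initial vertex $\iota(e)$ and terminal vertex $\tau(e)=\iota(\overline e)$. It is labelled with $X^{\pm}$ if each edge has a label $lab(e)\in X^{\pm}$ with $lab(\overline e)=lab(e)^{-1}$. The label of a path is the word read along it. $Lab(\Gamma,v_0)$ is the subgroup of $G$ of all elements represented by labels of closed paths at $v_0$ (if $V(\Gamma)=\{v_0\}$, $E(\Gamma)=\emptyset$, it is $\{1\}$); $(\Gamma,v_0)$ is said to determine this subgroup. Morphisms of labelled graphs commute with $\iota,\tau$ and preserve labels; pointed ones preserve basepoints. $\Gamma$ is $G$-based if every path $p$ with $lab(p)=_G1$ is closed. $Cayley(G_i,S)$,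 for $S\le G_i$, has vertices the right cosets $Sg$ and, for each $x\in X_i^{\pm}$, an edge labelled $x$ from $Sg$ to $Sgx$. A cover of $G_i$ is a labelled graph isomorphic to $Cayley(G_i,S)$ for some $S\le G_i$. Precovers. An $X_i$-monochromatic component of $\Gamma$ is a maximal connected subgraph labelled with $X_i^{\pm}$ containing at least one edge. A vertex is bichromatic if edges with labels in $X_1^{\pm}$ and edges with labels in $X_2^{\pm}$ start at it; $VB(C)$ denotes the set of vertices of a component $C$ that are bichromatic in $\Gamma$. A precover of $G$ is a connected $G$-based graph (labelled with $X^\pm$) in which each $X_i$-monochromatic component is a cover of $G_i$ ($i=1,2$); a single vertex with no edges is also a precover. For a vertex $v$ of an $X_i$-monochromatic component $C$ of a precover and $a\in A$, $v\cdot a$ is the endpoint of the path in $C$ starting at $v$ labelled by a word in $X_i^{\pm}$ representing $a$; $A(v)=\{v\cdot a: a\in A\}$. An $X_i$-monochromatic component $C$ of a precover $(\Gamma,v_0)$ is redundant if either (1) $\Gamma=C$ and $Lab(C,v_0)=\{1\}$; or (2) $\Gamma$ has at least two distinct monochromatic components and, for $\vartheta\in VB(C)$ and $K=Lab(C,\vartheta)$: (i) $K\le A$, (ii) $VB(C)=A(\vartheta)$, (iii) either $v_0\notin V(C)$, or $v_0\in VB(C)$ and $K=\{1\}$. A precover $(\Gamma,v_0)$ is reduced if (1) it has no redundant monochromatic components, and (2) if there is an $X_i$-monochromatic component $C$ with $v_0\in V(C)$ and $K\cap A\neq\{1\}$, where $K=Lab(C,v_0)$, then there is an $X_j$-monochromatic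 component $D$ ($1\le i\neq j\le2$) with $v_0\in V(D)$ and $K\cap A=_G L\cap A$, where $L=Lab(D,v_0)$.
   Formalization: Both precovers are assumed to have finitely many monochromatic components; without this the claim fails: if A is proper in both factors, the Cayley graph of G and the single vertex are non-isomorphic reduced precovers determining {1}. *)

theory Defs
  imports "HOL-Algebra.Coset"
begin

section \<open>Groups given by presentations\<close>

text \<open>A letter \<open>(x, True)\<close> stands for the generator \<open>x\<close> and \<open>(x, False)\<close> for its formal inverse;
  in particular a letter is always different from its inverse.\<close>

type_synonym 'x letter = "'x \<times> bool"
type_synonym 'x word = "'x letter list"

definition letters :: "'x set \<Rightarrow> 'x letter set" where
  "letters X = X \<times> UNIV"

definition words :: "'x set \<Rightarrow> 'x word set" where
  "words X = lists (letters X)"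

fun inv_letter :: "'x letter \<Rightarrow> 'x letter" where
  "inv_letter (x, b) = (x, \<not> b)"

definition inv_word :: "'x word \<Rightarrow> 'x word" where
  "inv_word w = rev (map inv_letter w)"

text \<open>\<open>word_eq X R u v\<close>: the words \<open>u\<close> and \<open>v\<close> over \<open>X\<close> represent the same element of
  \<open>gp\<langle>X | R\<rangle>\<close>, where \<open>R\<close> is a set of relators.  It is the equivalence relation generated by
  inserting and deleting trivial relators and elements of \<open>R\<close>.\<close>

inductive word_eq :: "'x set \<Rightarrow> 'x word set \<Rightarrow> 'x word \<Rightarrow> 'x word \<Rightarrow> bool"
  for X :: "'x set" and R :: "'x word set" where
  refl: "w \<in> words X \<Longrightarrow> word_eq X R w w"
| sym: "word_eq X R u v \<Longrightarrow> word_eq X R v u"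
| trans: "word_eq X R u v \<Longrightarrow> word_eq X R v w \<Longrightarrow> word_eq X R u w"
| cancel: "u \<in> words X \<Longrightarrow> v \<in> words X \<Longrightarrow> l \<in> letters X \<Longrightarrow>
    word_eq X R (u @ [l, inv_letter l] @ v) (u @ v)"
| relator: "u \<in> words X \<Longrightarrow> v \<in> words X \<Longrightarrow> r \<in> R \<Longrightarrow> r \<in> words X \<Longrightarrow>
    word_eq X R (u @ r @ v) (u @ v)"

definition word_class :: "'x set \<Rightarrow> 'x word set \<Rightarrow> 'x word \<Rightarrow> 'x word set" where
  "word_class X R w = {v. word_eq X R w v}"

definition presented_group :: "'x set \<Rightarrow> 'x word set \<Rightarrow> 'x word set monoid" where
  "presented_group X R =
    \<lparr> carrier = word_class X R ` words X,
      mult = (\<lambda>g h. \<Union>u\<in>g. \<Union>v\<in>h. word_class X R (u @ v)),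
      one = word_class X R [] \<rparr>"

lemma word_eq_words: "word_eq X R u v \<Longrightarrow> u \<in> words X \<and> v \<in> words X"
  by (induction rule: word_eq.induct) (auto simp: words_def letters_def)

lemma append_words: "u \<in> words X \<Longrightarrow> v \<in> words X \<Longrightarrow> u @ v \<in> words X"
  by (auto simp: words_def)

lemma inv_letter_inv_letter [simp]: "inv_letter (inv_letter l) = l"
  by (cases l) simp

lemma inv_word_words: "w \<in> words X \<Longrightarrow> inv_word w \<in> words X"
  by (fastforce simp: words_def inv_word_def letters_def)

lemma word_class_eq_iff:
  "u \<in> words X \<Longrightarrow> word_class X R u = word_class X R v \<longleftrightarrow> word_eq X R u v"
  unfolding word_class_def
  by (metis (no_types, lifting) Collect_cong mem_Collect_eq word_eq.refl word_eq.sym word_eq.trans)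

lemma word_eq_context:
  "word_eq X R u v \<Longrightarrow> a \<in> words X \<Longrightarrow> b \<in> words X \<Longrightarrow> word_eq X R (a @ u @ b) (a @ v @ b)"
proof (induction rule: word_eq.induct)
  case (cancel u v l)
  then show ?case using word_eq.cancel[of "a @ u" X "v @ b" l R] by (simp add: append_words)
next
  case (relator u v r)
  then show ?case using word_eq.relator[of "a @ u" X "v @ b" r R] by (simp add: append_words)
next
  case (refl w)
  then show ?case by (intro word_eq.refl append_words)
next
  case (sym u v)
  then show ?case by (blast intro: word_eq.sym)
next
  case (trans u v w)
  then show ?case by (blast intro: word_eq.trans)
qed

lemma word_eq_append:
  assumes "word_eq X R u u'" "word_eq X R v v'"
  shows "word_eq X R (u @ v) (u' @ v')"
proof (rule word_eq.trans)
  show "word_eq X R (u @ v) (u' @ v)"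
    using word_eq_context[OF assms(1), of "[]" v] word_eq_words[OF assms(2)]
    by (simp add: words_def)
  show "word_eq X R (u' @ v) (u' @ v')"
    using word_eq_context[OF assms(2), of u' "[]"] word_eq_words[OF assms(1)]
    by (simp add: words_def)
qed

lemma presented_group_mult:
  assumes "u \<in> words X" "v \<in> words X"
  shows "word_class X R u \<otimes>\<^bsub>presented_group X R\<^esub> word_class X R v = word_class X R (u @ v)"
proof -
  have *: "word_class X R (u' @ v') = word_class X R (u @ v)"
    if "u' \<in> word_class X R u" "v' \<in> word_class X R v" for u' v'
  proof -
    from that have "word_eq X R (u @ v) (u' @ v')"
      unfolding word_class_def mem_Collect_eq by (rule word_eq_append)
    then show ?thesis using word_class_eq_iff[OF append_words[OF assms]] by metis
  qed
  have "u \<in> word_class X R u" "v \<in> word_class X R v"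
    using assms by (simp_all add: word_class_def word_eq.refl)
  then have "(\<Union>u'\<in>word_class X R u. \<Union>v'\<in>word_class X R v. word_class X R (u' @ v'))
      = word_class X R (u @ v)"
    using * by blast
  then show ?thesis by (simp add: presented_group_def)
qed

lemma inv_word_left: "w \<in> words X \<Longrightarrow> word_eq X R (inv_word w @ w) []"
proof (induction w)
  case Nil
  then show ?case by (auto simp: inv_word_def intro: word_eq.refl)
next
  case (Cons l w)
  then have l: "l \<in> letters X" and w: "w \<in> words X" by (auto simp: words_def)
  from l have "inv_letter l \<in> letters X" by (cases l) (auto simp: letters_def)
  then have "word_eq X R (inv_word w @ [inv_letter l, inv_letter (inv_letter l)] @ w)
      (inv_word w @ w)"
    using w by (intro word_eq.cancel inv_word_words)
  then have "word_eq X R (inv_word w @ [inv_letter l, inv_letter (inv_letter l)] @ w) []"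
    using Cons.IH[OF w] by (rule word_eq.trans)
  then show ?case by (simp add: inv_word_def)
qed

lemma group_presented_group: "group (presented_group X R)"
proof (rule groupI)
  let ?G = "presented_group X R"
  have nil: "[] \<in> words X" by (simp add: words_def)
  have car: "g \<in> carrier ?G \<longleftrightarrow> (\<exists>w\<in>words X. g = word_class X R w)" for g
    by (auto simp: presented_group_def)
  have one: "\<one>\<^bsub>?G\<^esub> = word_class X R []" by (simp add: presented_group_def)
  show "\<one>\<^bsub>?G\<^esub> \<in> carrier ?G" using nil car one by blast
  show "x \<otimes>\<^bsub>?G\<^esub> y \<in> carrier ?G" if "x \<in> carrier ?G" "y \<in> carrier ?G" for x y
    using that car append_words by (metis presented_group_mult)
  show "x \<otimes>\<^bsub>?G\<^esub> y \<otimes>\<^bsub>?G\<^esub> z = x \<otimes>\<^bsub>?G\<^esub> (y \<otimes>\<^bsub>?G\<^esub> z)"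
    if "x \<in> carrier ?G" "y \<in> carrier ?G" "z \<in> carrier ?G" for x y z
    using that by (auto simp: car presented_group_mult append_words)
  show "\<one>\<^bsub>?G\<^esub> \<otimes>\<^bsub>?G\<^esub> x = x" if "x \<in> carrier ?G" for x
    using that car one nil by (auto simp: presented_group_mult)
  show "\<exists>y\<in>carrier ?G. y \<otimes>\<^bsub>?G\<^esub> x = \<one>\<^bsub>?G\<^esub>" if x: "x \<in> carrier ?G" for x
  proof -
    from x obtain w where w: "w \<in> words X" "x = word_class X R w" using car by blast
    have iw: "inv_word w \<in> words X" using w(1) by (rule inv_word_words)
    have "word_class X R (inv_word w) \<otimes>\<^bsub>?G\<^esub> x = \<one>\<^bsub>?G\<^esub>"
      using w iw one inv_word_left[OF w(1)] append_words[OF iw w(1)]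
      by (simp add: presented_group_mult word_class_eq_iff)
    then show ?thesis using iw car by blast
  qed
qed


section \<open>Amalgamated free products\<close>

datatype factor = F1 | F2

record ('x, 'a) amalgam_data =
  gens :: "factor \<Rightarrow> 'x set"
  rels :: "factor \<Rightarrow> 'x word set"
  amal :: "'a monoid"
  emb :: "factor \<Rightarrow> 'a \<Rightarrow> 'x word set"

definition factor_group :: "('x, 'a) amalgam_data \<Rightarrow> factor \<Rightarrow> 'x word set monoid" where
  "factor_group D i = presented_group (gens D i) (rels D i)"

definition amalgam :: "('x, 'a) amalgam_data \<Rightarrow> bool" where
  "amalgam D \<longleftrightarrow>
    (\<forall>i. finite (gens D i) \<and> finite (rels D i) \<and> rels D i \<subseteq> words (gens D i)) \<and>
    letters (gens D F1) \<inter> letters (gens D F2) = {} \<and>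
    group (amal D) \<and>
    (\<forall>i. emb D i \<in> mon (amal D) (factor_group D i))"

text \<open>\<open>represents D i u a\<close>: the word \<open>u\<close> in the letters of the \<open>i\<close>-th factor represents
  \<open>a \<in> A\<close>, where \<open>A\<close> is identified with its image in that factor.\<close>

definition represents :: "('x, 'a) amalgam_data \<Rightarrow> factor \<Rightarrow> 'x word \<Rightarrow> 'a \<Rightarrow> bool" where
  "represents D i u a \<longleftrightarrow> a \<in> carrier (amal D) \<and> u \<in> words (gens D i) \<and>
    word_class (gens D i) (rels D i) u = emb D i a"

definition all_gens :: "('x, 'a) amalgam_data \<Rightarrow> 'x set" where
  "all_gens D = gens D F1 \<union> gens D F2"

text \<open>The relations \<open>\<phi>\<^sub>1(a) = \<phi>\<^sub>2(a)\<close> are imposed for all \<open>a \<in> A\<close> and all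
  words representing the two sides; the relations for a generating set of \<open>A\<close> and one choice of
  words define the same group.\<close>

definition all_rels :: "('x, 'a) amalgam_data \<Rightarrow> 'x word set" where
  "all_rels D = rels D F1 \<union> rels D F2 \<union>
    {u @ inv_word v | u v. \<exists>a. represents D F1 u a \<and> represents D F2 v a}"

definition amalgam_group :: "('x, 'a) amalgam_data \<Rightarrow> 'x word set monoid" where
  "amalgam_group D = presented_group (all_gens D) (all_rels D)"

definition element :: "('x, 'a) amalgam_data \<Rightarrow> 'x word \<Rightarrow> 'x word set" where
  "element D w = word_class (all_gens D) (all_rels D) w"

text \<open>The image of \<open>A\<close> in the amalgam; the relations make it independent of the factor
  through which it is computed.\<close>

definition amal_image :: "('x, 'a) amalgam_data \<Rightarrow> 'x word set set" where
  "amal_image D = {element D u | u. \<exists>a. represents D F1 u a}"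


section \<open>Labelled graphs\<close>

text \<open>\<open>bar\<close> is the involution sending an edge to its inverse edge.  A subgraph shares the
  functions \<open>ini\<close>, \<open>bar\<close> and \<open>lab\<close> with the ambient graph; their values outside
  the edge set are irrelevant.\<close>

record ('v, 'e, 'x) lgraph =
  verts :: "'v set"
  edges :: "'e set"
  ini :: "'e \<Rightarrow> 'v"
  bar :: "'e \<Rightarrow> 'e"
  lab :: "'e \<Rightarrow> 'x letter"

definition ter :: "('v, 'e, 'x) lgraph \<Rightarrow> 'e \<Rightarrow> 'v" where
  "ter \<Gamma> e = ini \<Gamma> (bar \<Gamma> e)"

definition labelled_graph :: "'x set \<Rightarrow> ('v, 'e, 'x) lgraph \<Rightarrow> bool" where
  "labelled_graph X \<Gamma> \<longleftrightarrow> (\<forall>e\<in>edges \<Gamma>.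
    ini \<Gamma> e \<in> verts \<Gamma> \<and> bar \<Gamma> e \<in> edges \<Gamma> \<and> bar \<Gamma> (bar \<Gamma> e) = e \<and> bar \<Gamma> e \<noteq> e \<and>
    lab \<Gamma> e \<in> letters X \<and> lab \<Gamma> (bar \<Gamma> e) = inv_letter (lab \<Gamma> e))"

fun path :: "('v, 'e, 'x) lgraph \<Rightarrow> 'v \<Rightarrow> 'e list \<Rightarrow> 'v \<Rightarrow> bool" where
  "path \<Gamma> u [] v \<longleftrightarrow> u \<in> verts \<Gamma> \<and> u = v"
| "path \<Gamma> u (e # p) v \<longleftrightarrow> u \<in> verts \<Gamma> \<and> e \<in> edges \<Gamma> \<and> ini \<Gamma> e = u \<and> path \<Gamma> (ter \<Gamma> e) p v"

definition path_lab :: "('v, 'e, 'x) lgraph \<Rightarrow> 'e list \<Rightarrow> 'x word" where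
  "path_lab \<Gamma> p = map (lab \<Gamma>) p"

definition connected_graph :: "('v, 'e, 'x) lgraph \<Rightarrow> bool" where
  "connected_graph \<Gamma> \<longleftrightarrow>
    verts \<Gamma> \<noteq> {} \<and> (\<forall>u\<in>verts \<Gamma>. \<forall>v\<in>verts \<Gamma>. \<exists>p. path \<Gamma> u p v)"

definition subgraph :: "('v, 'e, 'x) lgraph \<Rightarrow> ('v, 'e, 'x) lgraph \<Rightarrow> bool" where
  "subgraph C \<Gamma> \<longleftrightarrow>
    verts C \<subseteq> verts \<Gamma> \<and> edges C \<subseteq> edges \<Gamma> \<and>
    ini C = ini \<Gamma> \<and> bar C = bar \<Gamma> \<and> lab C = lab \<Gamma> \<and>
    (\<forall>e\<in>edges C. ini C e \<in> verts C \<and> bar C e \<in> edges C)"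

definition graph_morphism ::
  "('v \<Rightarrow> 'w) \<Rightarrow> ('e \<Rightarrow> 'f) \<Rightarrow> ('v, 'e, 'x) lgraph \<Rightarrow> ('w, 'f, 'x) lgraph \<Rightarrow> bool" where
  "graph_morphism f g \<Gamma> \<Delta> \<longleftrightarrow>
    f ` verts \<Gamma> \<subseteq> verts \<Delta> \<and> g ` edges \<Gamma> \<subseteq> edges \<Delta> \<and>
    (\<forall>e\<in>edges \<Gamma>. ini \<Delta> (g e) = f (ini \<Gamma> e) \<and> ter \<Delta> (g e) = f (ter \<Gamma> e) \<and>
      lab \<Delta> (g e) = lab \<Gamma> e)"

definition graph_isomorphism ::
  "('v \<Rightarrow> 'w) \<Rightarrow> ('e \<Rightarrow> 'f) \<Rightarrow> ('v, 'e, 'x) lgraph \<Rightarrow> ('w, 'f, 'x) lgraph \<Rightarrow> bool" where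
  "graph_isomorphism f g \<Gamma> \<Delta> \<longleftrightarrow> graph_morphism f g \<Gamma> \<Delta> \<and>
    bij_betw f (verts \<Gamma>) (verts \<Delta>) \<and> bij_betw g (edges \<Gamma>) (edges \<Delta>)"

definition isomorphic :: "('v, 'e, 'x) lgraph \<Rightarrow> ('w, 'f, 'x) lgraph \<Rightarrow> bool" where
  "isomorphic \<Gamma> \<Delta> \<longleftrightarrow> (\<exists>f g. graph_isomorphism f g \<Gamma> \<Delta>)"

definition pointed_isomorphic ::
  "('v, 'e, 'x) lgraph \<Rightarrow> 'v \<Rightarrow> ('w, 'f, 'x) lgraph \<Rightarrow> 'w \<Rightarrow> bool" where
  "pointed_isomorphic \<Gamma> v \<Delta> w \<longleftrightarrow> (\<exists>f g. graph_isomorphism f g \<Gamma> \<Delta> \<and> f v = w)"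

text \<open>\<open>Lab D \<Gamma> v\<close> always consists of elements of the amalgam, also when \<open>\<Gamma>\<close> is a
  monochromatic component, so that it can be compared with the image of \<open>A\<close>.\<close>

definition Lab :: "('x, 'a) amalgam_data \<Rightarrow> ('v, 'e, 'x) lgraph \<Rightarrow> 'v \<Rightarrow> 'x word set set" where
  "Lab D \<Gamma> v = {element D (path_lab \<Gamma> p) | p. path \<Gamma> v p v}"

definition G_based :: "('x, 'a) amalgam_data \<Rightarrow> ('v, 'e, 'x) lgraph \<Rightarrow> bool" where
  "G_based D \<Gamma> \<longleftrightarrow> (\<forall>u p v. path \<Gamma> u p v \<longrightarrow>
    word_eq (all_gens D) (all_rels D) (path_lab \<Gamma> p) [] \<longrightarrow> u = v)"


section \<open>Covers and precovers\<close>

text \<open>The edge of the Cayley graph labelled \<open>l\<close> from the coset \<open>c\<close> to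
  \<open>c #> l\<close> is the pair \<open>(c, l)\<close>; its inverse is \<open>(c #> l, inv_letter l)\<close>.\<close>

definition cayley :: "('x, 'a) amalgam_data \<Rightarrow> factor \<Rightarrow> 'x word set set \<Rightarrow>
    ('x word set set, 'x word set set \<times> 'x letter, 'x) lgraph" where
  "cayley D i S =
    \<lparr> verts = rcosets\<^bsub>factor_group D i\<^esub> S,
      edges = (rcosets\<^bsub>factor_group D i\<^esub> S) \<times> letters (gens D i),
      ini = fst,
      bar = (\<lambda>(c, l). (c #>\<^bsub>factor_group D i\<^esub> word_class (gens D i) (rels D i) [l],
                       inv_letter l)),
      lab = snd \<rparr>"

definition cover :: "('x, 'a) amalgam_data \<Rightarrow> factor \<Rightarrow> ('v, 'e, 'x) lgraph \<Rightarrow> bool" where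
  "cover D i C \<longleftrightarrow> (\<exists>S. subgroup S (factor_group D i) \<and> isomorphic C (cayley D i S))"

definition mono_subgraph ::
  "('x, 'a) amalgam_data \<Rightarrow> factor \<Rightarrow> ('v, 'e, 'x) lgraph \<Rightarrow> ('v, 'e, 'x) lgraph \<Rightarrow> bool" where
  "mono_subgraph D i \<Gamma> C \<longleftrightarrow> subgraph C \<Gamma> \<and> connected_graph C \<and> edges C \<noteq> {} \<and>
    (\<forall>e\<in>edges C. lab C e \<in> letters (gens D i))"

definition mono_component ::
  "('x, 'a) amalgam_data \<Rightarrow> factor \<Rightarrow> ('v, 'e, 'x) lgraph \<Rightarrow> ('v, 'e, 'x) lgraph \<Rightarrow> bool" where
  "mono_component D i \<Gamma> C \<longleftrightarrow> mono_subgraph D i \<Gamma> C \<and>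
    (\<forall>C'. mono_subgraph D i \<Gamma> C' \<and> subgraph C C' \<longrightarrow> C' = C)"

definition mono_components ::
  "('x, 'a) amalgam_data \<Rightarrow> ('v, 'e, 'x) lgraph \<Rightarrow> ('v, 'e, 'x) lgraph set" where
  "mono_components D \<Gamma> = {C. \<exists>i. mono_component D i \<Gamma> C}"

definition bichromatic :: "('x, 'a) amalgam_data \<Rightarrow> ('v, 'e, 'x) lgraph \<Rightarrow> 'v \<Rightarrow> bool" where
  "bichromatic D \<Gamma> v \<longleftrightarrow>
    (\<forall>i. \<exists>e\<in>edges \<Gamma>. ini \<Gamma> e = v \<and> lab \<Gamma> e \<in> letters (gens D i))"

definition VB :: "('x, 'a) amalgam_data \<Rightarrow> ('v, 'e, 'x) lgraph \<Rightarrow> ('v, 'e, 'x) lgraph \<Rightarrow> 'v set" where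
  "VB D \<Gamma> C = {v \<in> verts C. bichromatic D \<Gamma> v}"

text \<open>A graph with a single vertex and no edges has no monochromatic components and hence is a
  precover.\<close>

definition precover :: "('x, 'a) amalgam_data \<Rightarrow> ('v, 'e, 'x) lgraph \<Rightarrow> bool" where
  "precover D \<Gamma> \<longleftrightarrow> labelled_graph (all_gens D) \<Gamma> \<and> connected_graph \<Gamma> \<and> G_based D \<Gamma> \<and>
    (\<forall>i C. mono_component D i \<Gamma> C \<longrightarrow> cover D i C)"

text \<open>The set \<open>A(v)\<close> for a vertex \<open>v\<close> of a component \<open>C\<close> of the \<open>i\<close>-th
  colour.\<close>

definition amal_orbit ::
  "('x, 'a) amalgam_data \<Rightarrow> factor \<Rightarrow> ('v, 'e, 'x) lgraph \<Rightarrow> 'v \<Rightarrow> 'v set" where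
  "amal_orbit D i C v = {w. \<exists>a p. represents D i (path_lab C p) a \<and> path C v p w}"

text \<open>In the second alternative the bichromatic vertices of \<open>C\<close> form one \<open>A\<close>-orbit,
  so it does not matter which of them is taken for \<open>\<theta>\<close>.\<close>

definition redundant ::
  "('x, 'a) amalgam_data \<Rightarrow> ('v, 'e, 'x) lgraph \<Rightarrow> 'v \<Rightarrow> factor \<Rightarrow> ('v, 'e, 'x) lgraph \<Rightarrow> bool" where
  "redundant D \<Gamma> v\<^sub>0 i C \<longleftrightarrow> mono_component D i \<Gamma> C \<and>
    (C = \<Gamma> \<and> Lab D C v\<^sub>0 = {\<one>\<^bsub>amalgam_group D\<^esub>} \<or>
     (\<exists>C'\<in>mono_components D \<Gamma>. C' \<noteq> C) \<and>
     (\<exists>\<theta>\<in>VB D \<Gamma> C.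
        Lab D C \<theta> \<subseteq> amal_image D \<and>
        VB D \<Gamma> C = amal_orbit D i C \<theta> \<and>
        (v\<^sub>0 \<notin> verts C \<or> v\<^sub>0 \<in> VB D \<Gamma> C \<and> Lab D C \<theta> = {\<one>\<^bsub>amalgam_group D\<^esub>})))"

definition reduced_precover ::
  "('x, 'a) amalgam_data \<Rightarrow> ('v, 'e, 'x) lgraph \<Rightarrow> 'v \<Rightarrow> bool" where
  "reduced_precover D \<Gamma> v\<^sub>0 \<longleftrightarrow> precover D \<Gamma> \<and> v\<^sub>0 \<in> verts \<Gamma> \<and>
    (\<forall>i C. \<not> redundant D \<Gamma> v\<^sub>0 i C) \<and>
    (\<forall>i C. mono_component D i \<Gamma> C \<and> v\<^sub>0 \<in> verts C \<and>
        Lab D C v\<^sub>0 \<inter> amal_image D \<noteq> {\<one>\<^bsub>amalgam_group D\<^esub>} \<longrightarrow>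
      (\<exists>j C'. j \<noteq> i \<and> mono_component D j \<Gamma> C' \<and> v\<^sub>0 \<in> verts C' \<and>
        Lab D C v\<^sub>0 \<inter> amal_image D = Lab D C' v\<^sub>0 \<inter> amal_image D))"

text \<open>Uniqueness of reduced precovers is a statement about graphs with finitely many
  monochromatic components (the components themselves may be infinite): if \<open>A\<close> is proper in
  both factors, the Cayley graph of the whole amalgam and the graph with a single vertex and no
  edges are both reduced in the above sense and determine the trivial subgroup.\<close>

definition finitely_many_components ::
  "('x, 'a) amalgam_data \<Rightarrow> ('v, 'e, 'x) lgraph \<Rightarrow> bool" where
  "finitely_many_components D \<Gamma> \<longleftrightarrow> finite (mono_components D \<Gamma>)"

end

theory Submission
  imports Defs
begin

text \<open>
The two precovers determine the same subgroup \<open>H\<close> of \<open>G\<close>.  Since a precover is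
\<open>G\<close>-based, the vertex reached from the base point by a path with label \<open>g\<close> may be
identified with the coset \<open>H g\<close>, and since its monochromatic components are covers, an edge is
determined by its initial vertex and its label, and all letters of a colour start at a vertex as soon as
one of them does.  So a precover is known once it is known, for \<open>i = F1, F2\<close>, which set
\<open>N i\<close> of elements of \<open>G\<close> leads to vertices with edges of the \<open>i\<close>-th colour.
This set is invariant under \<open>H\<close> on the left and under \<open>G\<^sub>i\<close> on the right; its cosets
\<open>g G\<^sub>i\<close> are vertices of the Bass--Serre tree of the amalgam.  Connectedness of the graph,
together with the fact that it carries all of \<open>H\<close>, says that these vertices span an
\<open>H\<close>-invariant subtree (\<open>subtree_N\<close>); its edges correspond to the \<open>A\<close>-orbits of
bichromatic vertices.  What remains is a statement about \<open>H\<close>-invariant subtrees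
with finite quotient.

Let \<open>M\<close> and \<open>N\<close> be two such subtrees, both coming from reduced precovers, and suppose
\<open>N\<close> is not contained in \<open>M\<close>.  Among the invariant proper subtrees of \<open>M \<union> N\<close> that
contain \<open>M\<close> there is a maximal one, \<open>M'\<close>, because the quotient is finite; by maximality
\<open>M \<union> N\<close> arises from \<open>M'\<close> by attaching a single orbit of tree vertices, that of some
\<open>g G\<^sub>i\<close> in \<open>N\<close>.  Subtrees are convex, so \<open>g G\<^sub>i\<close> is joined to \<open>M'\<close>
by at most one edge.  In the second graph the corresponding component therefore has at most one
\<open>A\<close>-orbit of bichromatic vertices, and its group lies in \<open>A\<close>: it is redundant, unless it
contains the base point.  In that exceptional case the base point of the first graph does not lie in a
component of the \<open>i\<close>-th colour, and the condition on \<open>H \<inter> A\<close> in the definition of a reduced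
precover, applied to the first graph, forces \<open>H \<inter> G\<^sub>i\<close> to be trivial, which again makes the
component redundant (\<open>tight_subtree_le\<close>).  By symmetry \<open>M = N\<close>, and the graphs are
isomorphic.

The only property of the Bass--Serre tree that enters is that it has no circuits: a nonempty product of
elements taken alternately from \<open>G\<^sub>1 - A\<close> and \<open>G\<^sub>2 - A\<close> is never trivial.  This is
proved with van der Waerden's method, by letting the amalgam act on normal forms
(\<open>zigzag_not_closed\<close>).
\<close>

section \<open>The action of an amalgam on normal forms\<close>

fun other :: "factor \<Rightarrow> factor" where
  "other F1 = F2"
| "other F2 = F1"

lemma other_neq [simp]: "other i \<noteq> i" "i \<noteq> other i"
  by (cases i; simp)+

lemma neq_iff_other: "j \<noteq> i \<longleftrightarrow> j = other i"
  by (cases i; cases j) auto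

lemma all_factor: "(\<forall>i. Q i) \<longleftrightarrow> Q j \<and> Q (other j)"
  by (metis neq_iff_other)

locale amalgamated_pair =
  fixes A :: "'a monoid" and P :: "factor \<Rightarrow> 'b monoid" and \<phi> :: "factor \<Rightarrow> 'a \<Rightarrow> 'b"
  assumes group_A: "group A" and group_P: "\<And>i. group (P i)"
    and mon: "\<And>i. \<phi> i \<in> mon A (P i)"
begin

sublocale A: group A by (rule group_A)
sublocale P: group "P i" for i by (rule group_P)
sublocale emb: group_hom A "P i" "\<phi> i" for i
  using mon[of i] by unfold_locales (simp add: mon_def)

lemma emb_inj: "a \<in> carrier A \<Longrightarrow> b \<in> carrier A \<Longrightarrow> \<phi> i a = \<phi> i b \<longleftrightarrow> a = b"
  using mon[of i] by (auto simp: mon_def inj_on_def)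

abbreviation img :: "factor \<Rightarrow> 'b set" where
  "img i \<equiv> \<phi> i ` carrier A"

lemma img_subgroup: "subgroup (img i) (P i)"
  by (rule emb.img_is_subgroup)

text \<open>A right transversal of the image of \<open>A\<close> in the \<open>i\<close>-th factor.  The coset of the image
itself must be represented by the unit: elements of \<open>A\<close> then contribute no syllable to a normal
form.\<close>

definition rep :: "factor \<Rightarrow> 'b \<Rightarrow> 'b" where
  "rep i g = (if g \<in> img i then \<one>\<^bsub>P i\<^esub> else SOME x. x \<in> img i #>\<^bsub>P i\<^esub> g)"

definition coef :: "factor \<Rightarrow> 'b \<Rightarrow> 'a" where
  "coef i g = (SOME a. a \<in> carrier A \<and> g = \<phi> i a \<otimes>\<^bsub>P i\<^esub> rep i g)"

lemma img_mult_iff: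
  assumes "a \<in> carrier A" "g \<in> carrier (P i)"
  shows "\<phi> i a \<otimes>\<^bsub>P i\<^esub> g \<in> img i \<longleftrightarrow> g \<in> img i"
proof
  assume "\<phi> i a \<otimes>\<^bsub>P i\<^esub> g \<in> img i"
  then obtain b where b: "b \<in> carrier A" "\<phi> i a \<otimes>\<^bsub>P i\<^esub> g = \<phi> i b" by blast
  have "\<phi> i (inv\<^bsub>A\<^esub> a \<otimes>\<^bsub>A\<^esub> b) = inv\<^bsub>P i\<^esub> \<phi> i a \<otimes>\<^bsub>P i\<^esub> (\<phi> i a \<otimes>\<^bsub>P i\<^esub> g)"
    using assms(1) b by simp
  also have "\<dots> = g" using assms by (simp add: P.m_assoc[symmetric])
  finally show "g \<in> img i" using assms(1) b(1) by (metis A.inv_closed A.m_closed imageI)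
next
  assume "g \<in> img i"
  then show "\<phi> i a \<otimes>\<^bsub>P i\<^esub> g \<in> img i"
    using assms(1) img_subgroup[of i] by (auto intro: subgroup.m_closed)
qed

lemma rep_emb_mult:
  assumes "a \<in> carrier A" "g \<in> carrier (P i)"
  shows "rep i (\<phi> i a \<otimes>\<^bsub>P i\<^esub> g) = rep i g"
proof -
  have "img i #>\<^bsub>P i\<^esub> (\<phi> i a \<otimes>\<^bsub>P i\<^esub> g) = (img i #>\<^bsub>P i\<^esub> \<phi> i a) #>\<^bsub>P i\<^esub> g"
    using assms by (metis P.coset_mult_assoc emb.hom_closed P.subgroupE(1) img_subgroup)
  also have "img i #>\<^bsub>P i\<^esub> \<phi> i a = img i"
    using assms(1) by (intro P.coset_join2 img_subgroup) auto
  finally show ?thesis using img_mult_iff[OF assms] by (simp add: rep_def)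
qed

lemma rep_cases:
  assumes "g \<in> carrier (P i)"
  shows "rep i g \<in> carrier (P i) \<and> (\<exists>a\<in>carrier A. g = \<phi> i a \<otimes>\<^bsub>P i\<^esub> rep i g)"
proof (cases "g \<in> img i")
  case True
  then show ?thesis by (auto simp: rep_def)
next
  case False
  have "g \<in> img i #>\<^bsub>P i\<^esub> g" using assms P.rcos_self img_subgroup by blast
  then have "rep i g \<in> img i #>\<^bsub>P i\<^esub> g" using False by (simp add: rep_def) (rule someI)
  then obtain a where a: "a \<in> carrier A" "rep i g = \<phi> i a \<otimes>\<^bsub>P i\<^esub> g"
    by (auto simp: r_coset_def)
  then have "g = \<phi> i (inv\<^bsub>A\<^esub> a) \<otimes>\<^bsub>P i\<^esub> rep i g"
    using assms by (simp add: P.m_assoc[symmetric])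
  moreover have "rep i g \<in> carrier (P i)" using a assms by simp
  ultimately show ?thesis using a(1) by blast
qed

lemma rep_closed [simp]: "g \<in> carrier (P i) \<Longrightarrow> rep i g \<in> carrier (P i)"
  using rep_cases by blast

lemma coef:
  assumes "g \<in> carrier (P i)"
  shows "coef i g \<in> carrier A" "\<phi> i (coef i g) \<otimes>\<^bsub>P i\<^esub> rep i g = g"
proof -
  have "\<exists>a. a \<in> carrier A \<and> g = \<phi> i a \<otimes>\<^bsub>P i\<^esub> rep i g"
    using rep_cases[OF assms] by blast
  then have "coef i g \<in> carrier A \<and> g = \<phi> i (coef i g) \<otimes>\<^bsub>P i\<^esub> rep i g"
    unfolding coef_def by (rule someI_ex)
  then show "coef i g \<in> carrier A" "\<phi> i (coef i g) \<otimes>\<^bsub>P i\<^esub> rep i g = g" by auto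
qed

lemma coef_emb_mult:
  assumes "a \<in> carrier A" "t \<in> carrier (P i)" "rep i t = t"
  shows "coef i (\<phi> i a \<otimes>\<^bsub>P i\<^esub> t) = a"
proof -
  let ?g = "\<phi> i a \<otimes>\<^bsub>P i\<^esub> t"
  have g: "?g \<in> carrier (P i)" using assms by simp
  have "\<phi> i (coef i ?g) \<otimes>\<^bsub>P i\<^esub> t = \<phi> i a \<otimes>\<^bsub>P i\<^esub> t"
    using coef(2)[OF g] rep_emb_mult[OF assms(1,2)] assms(3) by simp
  then show ?thesis
    using coef(1)[OF g] assms by (simp add: emb_inj)
qed

lemma rep_rep: "g \<in> carrier (P i) \<Longrightarrow> rep i (rep i g) = rep i g"
  using rep_emb_mult[of "coef i g" "rep i g" i] coef[of g i] by simp

lemma rep_in_img_iff: "g \<in> carrier (P i) \<Longrightarrow> rep i g \<in> img i \<longleftrightarrow> g \<in> img i"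
  using img_mult_iff[of "coef i g" "rep i g" i] coef[of g i] by simp

lemma rep_one: "g \<in> img i \<Longrightarrow> rep i g = \<one>\<^bsub>P i\<^esub>"
  by (simp add: rep_def)

fun avoids :: "factor \<Rightarrow> (factor \<times> 'b) list \<Rightarrow> bool" where
  "avoids i [] \<longleftrightarrow> True"
| "avoids i ((k, t) # s) \<longleftrightarrow> k \<noteq> i"

text \<open>A normal form is a pair \<open>(a, s)\<close> standing for the product of \<open>a \<in> A\<close> and the nontrivial coset
representatives listed in \<open>s\<close>, in which neighbours come from different factors.\<close>

fun normal :: "(factor \<times> 'b) list \<Rightarrow> bool" where
  "normal [] \<longleftrightarrow> True"
| "normal ((i, t) # s) \<longleftrightarrow>
    t \<in> carrier (P i) \<and> t \<notin> img i \<and> rep i t = t \<and> avoids i s \<and> normal s"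

definition forms :: "('a \<times> (factor \<times> 'b) list) set" where
  "forms = {(a, s). a \<in> carrier A \<and> normal s}"

text \<open>For each \<open>i\<close> the normal forms are in bijection, by \<open>split\<close> and \<open>join\<close>, with the
pairs of an element of the \<open>i\<close>-th factor and a list that does not start with a syllable of
this factor: the first component of the pair collects \<open>a\<close> and a first syllable from that factor,
if there is one.  Left multiplication on the first component of such pairs is obviously an action, so no
case distinction is needed to see that \<open>act\<close> is one.\<close>

fun split :: "factor \<Rightarrow> 'a \<times> (factor \<times> 'b) list \<Rightarrow> 'b \<times> (factor \<times> 'b) list" where
  "split i (a, []) = (\<phi> i a, [])"
| "split i (a, (k, t) # s) = (if k = i then (\<phi> i a \<otimes>\<^bsub>P i\<^esub> t, s) else (\<phi> i a, (k, t) # s))"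

fun join :: "factor \<Rightarrow> 'b \<times> (factor \<times> 'b) list \<Rightarrow> 'a \<times> (factor \<times> 'b) list" where
  "join i (g, s) = (coef i g, if g \<in> img i then s else (i, rep i g) # s)"

definition act :: "factor \<Rightarrow> 'b \<Rightarrow> 'a \<times> (factor \<times> 'b) list \<Rightarrow> 'a \<times> (factor \<times> 'b) list" where
  "act i g \<omega> = join i (g \<otimes>\<^bsub>P i\<^esub> fst (split i \<omega>), snd (split i \<omega>))"

lemma split_closed:
  assumes "\<omega> \<in> forms"
  shows "fst (split i \<omega>) \<in> carrier (P i) \<and> normal (snd (split i \<omega>)) \<and> avoids i (snd (split i \<omega>))"
  using assms by (cases "(i, \<omega>)" rule: split.cases) (auto simp: forms_def)

lemma coef_img: "a \<in> carrier A \<Longrightarrow> coef i (\<phi> i a) = a"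
  using coef_emb_mult[of a "\<one>\<^bsub>P i\<^esub>" i] rep_one[of "\<one>\<^bsub>P i\<^esub>" i] img_subgroup[of i]
  by (simp add: subgroup.one_closed)

lemma join_split:
  assumes "\<omega> \<in> forms"
  shows "join i (split i \<omega>) = \<omega>"
proof -
  obtain a s where \<omega>: "\<omega> = (a, s)" by fastforce
  have a: "a \<in> carrier A" using assms \<omega> by (simp add: forms_def)
  show ?thesis
  proof (cases "avoids i s")
    case True
    then have "split i \<omega> = (\<phi> i a, s)" unfolding \<omega> by (cases s) auto
    then show ?thesis using a \<omega> by (simp add: coef_img)
  next
    case False
    then obtain t s' where s: "s = (i, t) # s'" by (cases "(i, s)" rule: avoids.cases) auto
    then have t: "t \<in> carrier (P i)" "t \<notin> img i" "rep i t = t"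
      using assms \<omega> by (auto simp: forms_def)
    have "\<phi> i a \<otimes>\<^bsub>P i\<^esub> t \<notin> img i" using img_mult_iff[OF a t(1)] t(2) by blast
    then show ?thesis
      using a t by (simp add: \<omega> s coef_emb_mult rep_emb_mult)
  qed
qed

lemma join_closed:
  "g \<in> carrier (P i) \<Longrightarrow> normal s \<Longrightarrow> avoids i s \<Longrightarrow> join i (g, s) \<in> forms"
  by (simp add: forms_def coef rep_in_img_iff rep_rep)

lemma split_join:
  assumes "g \<in> carrier (P i)" "avoids i s"
  shows "split i (join i (g, s)) = (g, s)"
proof (cases "g \<in> img i")
  case True
  then have "\<phi> i (coef i g) = g" using coef[OF assms(1)] rep_one by simp
  then show ?thesis using True assms(2) by (cases s) auto
next
  case False
  then show ?thesis using coef[OF assms(1)] by simp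
qed

lemma act_closed: "g \<in> carrier (P i) \<Longrightarrow> \<omega> \<in> forms \<Longrightarrow> act i g \<omega> \<in> forms"
  unfolding act_def using split_closed[of \<omega> i] by (intro join_closed) auto

lemma act_one: "\<omega> \<in> forms \<Longrightarrow> act i \<one>\<^bsub>P i\<^esub> \<omega> = \<omega>"
  unfolding act_def using split_closed[of \<omega> i] join_split[of \<omega> i] by simp

lemma act_mult:
  assumes "g \<in> carrier (P i)" "h \<in> carrier (P i)" "\<omega> \<in> forms"
  shows "act i (g \<otimes>\<^bsub>P i\<^esub> h) \<omega> = act i g (act i h \<omega>)"
  unfolding act_def using assms split_closed[OF assms(3), of i]
  by (simp add: split_join P.m_assoc del: join.simps)

text \<open>Both factors induce the same action of \<open>A\<close>, namely left multiplication on the first component;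
hence the two actions combine to an action of the amalgam.\<close>

lemma act_emb:
  assumes "a \<in> carrier A" "(b, s) \<in> forms"
  shows "act i (\<phi> i a) (b, s) = (a \<otimes>\<^bsub>A\<^esub> b, s)"
proof -
  have "split i (a \<otimes>\<^bsub>A\<^esub> b, s) = (\<phi> i a \<otimes>\<^bsub>P i\<^esub> fst (split i (b, s)), snd (split i (b, s)))"
    using assms by (cases "(i, (b, s))" rule: split.cases) (auto simp: forms_def P.m_assoc)
  moreover have "(a \<otimes>\<^bsub>A\<^esub> b, s) \<in> forms" using assms by (simp add: forms_def)
  ultimately show ?thesis
    unfolding act_def using join_split[of "(a \<otimes>\<^bsub>A\<^esub> b, s)" i] by simp
qed

lemma act_lengthens:
  assumes "g \<in> carrier (P i)" "g \<notin> img i" "\<omega> \<in> forms" "avoids i (snd \<omega>)"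
  shows "\<exists>t. snd (act i g \<omega>) = (i, t) # snd \<omega>"
proof -
  obtain a s where \<omega>: "\<omega> = (a, s)" by fastforce
  then have sp: "split i \<omega> = (\<phi> i a, s)" using assms(4) by (cases s) auto
  have a: "a \<in> carrier A" using assms(3) \<omega> by (simp add: forms_def)
  have "g \<otimes>\<^bsub>P i\<^esub> \<phi> i a \<notin> img i"
  proof
    assume "g \<otimes>\<^bsub>P i\<^esub> \<phi> i a \<in> img i"
    then obtain b where "b \<in> carrier A" "g \<otimes>\<^bsub>P i\<^esub> \<phi> i a = \<phi> i b" by blast
    then have "g = \<phi> i (b \<otimes>\<^bsub>A\<^esub> inv\<^bsub>A\<^esub> a)"
      using a assms(1) by (simp add: P.inv_solve_right)
    then show False using assms(2) \<open>b \<in> carrier A\<close> a by (metis A.inv_closed A.m_closed imageI)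
  qed
  then show ?thesis by (simp add: act_def sp) (simp add: \<omega>)
qed

end

section \<open>Invariant subtrees of the Bass--Serre tree\<close>

locale factor_subgroups = group G for G :: "('g, 'm) monoid_scheme" (structure) +
  fixes F :: "factor \<Rightarrow> 'g set" and A :: "'g set"
  assumes F_sub: "\<And>i. subgroup (F i) G" and A_sub: "subgroup A G" and A_le: "\<And>i. A \<subseteq> F i"
begin

lemma F_carrier: "x \<in> F i \<Longrightarrow> x \<in> carrier G"
  using F_sub subgroup.mem_carrier by metis

lemma A_carrier: "x \<in> A \<Longrightarrow> x \<in> carrier G"
  using A_sub subgroup.mem_carrier by metis

lemma F_mult: "x \<in> F i \<Longrightarrow> y \<in> F i \<Longrightarrow> x \<otimes> y \<in> F i"
  using F_sub subgroup.m_closed by metis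

lemma F_inv: "x \<in> F i \<Longrightarrow> inv x \<in> F i"
  using F_sub subgroup.m_inv_closed by metis

lemma F_one: "\<one> \<in> F i"
  using F_sub subgroup.one_closed by metis

lemma A_mult: "x \<in> A \<Longrightarrow> y \<in> A \<Longrightarrow> x \<otimes> y \<in> A"
  using A_sub subgroup.m_closed by metis

lemma A_inv: "x \<in> A \<Longrightarrow> inv x \<in> A"
  using A_sub subgroup.m_inv_closed by metis

lemma A_one: "\<one> \<in> A"
  using A_sub subgroup.one_closed by metis

lemma A_F: "x \<in> A \<Longrightarrow> x \<in> F i"
  using A_le by blast

lemma F_A_mult:
  assumes "y \<in> F i - A" "a \<in> A"
  shows "a \<otimes> y \<in> F i - A"
proof -
  have "a \<otimes> y \<notin> A"
  proof
    assume *: "a \<otimes> y \<in> A"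
    have "y = inv a \<otimes> (a \<otimes> y)"
      using assms(1) A_carrier[OF assms(2)] F_carrier[of y i] by (simp add: m_assoc[symmetric])
    then show False using A_mult[OF A_inv[OF assms(2)] *] assms(1) by simp
  qed
  then show ?thesis using assms A_F F_mult by blast
qed

lemma F_A_inv: "y \<in> F i - A \<Longrightarrow> inv y \<in> F i - A"
  using A_inv[of "inv y"] F_inv F_carrier by auto

text \<open>A path without backtracking in the Bass--Serre tree: the vertices are the cosets
\<open>t \<otimes> F i\<close>, the edges are the cosets \<open>t \<otimes> A\<close>, and a step by \<open>y \<in> F i\<close> leads from the
edge of \<open>t\<close> to another edge at the same vertex precisely when \<open>y \<notin> A\<close>.  The family
\<open>M\<close> tells which vertices may be visited: \<open>t \<otimes> F i\<close> is one of them if \<open>t \<in> M i\<close>.\<close>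

inductive zigzag :: "(factor \<Rightarrow> 'g set) \<Rightarrow> factor \<Rightarrow> 'g \<Rightarrow> 'g \<Rightarrow> bool" for M where
  single: "t \<in> M i \<Longrightarrow> y \<in> F i - A \<Longrightarrow> zigzag M i t (t \<otimes> y)"
| cons: "t \<in> M i \<Longrightarrow> y \<in> F i - A \<Longrightarrow> zigzag M k (t \<otimes> y) t' \<Longrightarrow> k \<noteq> i \<Longrightarrow> zigzag M i t t'"

lemma zigzag_mono: "zigzag M i t t' \<Longrightarrow> (\<And>i. M i \<subseteq> N i) \<Longrightarrow> zigzag N i t t'"
  by (induction rule: zigzag.induct) (blast intro: zigzag.intros)+

lemma zigzag_start: "zigzag M i t t' \<Longrightarrow> t \<in> M i"
  by (induction rule: zigzag.induct)

definition coset_closed :: "(factor \<Rightarrow> 'g set) \<Rightarrow> bool" where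
  "coset_closed M \<longleftrightarrow> (\<forall>i. M i \<subseteq> carrier G \<and> (\<forall>g\<in>M i. \<forall>x\<in>F i. g \<otimes> x \<in> M i))"

lemma coset_closedD:
  assumes "coset_closed M"
  shows "g \<in> M i \<Longrightarrow> g \<in> carrier G" "g \<in> M i \<Longrightarrow> x \<in> F i \<Longrightarrow> g \<otimes> x \<in> M i"
  using assms unfolding coset_closed_def by blast+

text \<open>The starting edge of the path is the coset \<open>t \<otimes> A\<close>, not the element \<open>t\<close>.\<close>

lemma zigzag_absorb:
  assumes M: "coset_closed M" and z: "zigzag M i t t'" and a: "a \<in> A"
  shows "zigzag M i (t \<otimes> a) t'"
proof -
  have ta: "t \<in> carrier G" "t \<otimes> a \<in> M i"
    using coset_closedD[OF M] zigzag_start[OF z] A_F[OF a] by blast+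
  have *: "t \<otimes> a \<otimes> (inv a \<otimes> y) = t \<otimes> y" if "y \<in> F i" for y
  proof -
    have yc: "y \<in> carrier G" and ac: "a \<in> carrier G" using F_carrier[OF that] A_carrier[OF a] .
    then have "t \<otimes> a \<otimes> (inv a \<otimes> y) = t \<otimes> (a \<otimes> inv a \<otimes> y)"
      using ta(1) by (simp only: m_assoc m_closed inv_closed)
    then show ?thesis using yc ac by simp
  qed
  from z show ?thesis
  proof cases
    case (single y)
    then show ?thesis
      using zigzag.single[of "t \<otimes> a" M i "inv a \<otimes> y"] ta F_A_mult[of y i "inv a"] A_inv[OF a] *[of y]
      by simp
  next
    case (cons y k)
    then show ?thesis
      using zigzag.cons[of "t \<otimes> a" M i "inv a \<otimes> y" k t'] ta F_A_mult[of y i "inv a"] A_inv[OF a]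
        *[of y] by simp
  qed
qed

definition step :: "(factor \<Rightarrow> 'g set) \<Rightarrow> 'g \<Rightarrow> 'g \<Rightarrow> bool" where
  "step M g g' \<longleftrightarrow> (\<exists>i. g \<in> M i \<and> (\<exists>x\<in>F i. g' = g \<otimes> x))"

lemma step_mono: "(step M)\<^sup>*\<^sup>* g g' \<Longrightarrow> (\<And>i. M i \<subseteq> N i) \<Longrightarrow> (step N)\<^sup>*\<^sup>* g g'"
  by (erule rtranclp_mono[THEN predicate2D, rotated]) (unfold step_def, blast)

lemma step_sym:
  assumes M: "coset_closed M" and s: "(step M)\<^sup>*\<^sup>* g g'"
  shows "(step M)\<^sup>*\<^sup>* g' g"
proof -
  have "symp (step M)"
  proof (rule sympI)
    fix g g' assume "step M g g'"
    then obtain i x where ix: "g \<in> M i" "x \<in> F i" "g' = g \<otimes> x" unfolding step_def by blast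
    then have "g' \<in> M i" "g = g' \<otimes> inv x"
      using coset_closedD[OF M] F_carrier by (auto simp: m_assoc)
    then show "step M g' g" unfolding step_def using F_inv[OF ix(2)] by blast
  qed
  then show ?thesis using s by (metis sympD symp_rtranclp)
qed

text \<open>Every path can be reduced without leaving the vertices that it visits.  A new first step merges with
the first step of the reduced path if both lie in the same factor, and is absorbed by the starting edge if
it lies in \<open>A\<close>.\<close>

lemma steps_zigzag:
  assumes M: "coset_closed M" and s: "(step M)\<^sup>*\<^sup>* t t'" and t': "t' \<in> carrier G"
  shows "(\<exists>a\<in>A. t' = t \<otimes> a) \<or> (\<exists>i. zigzag M i t t')"
  using s
proof (induction rule: converse_rtranclp_induct)
  case base
  then show ?case using A_one t' by force
next
  case (step t s)
  note cl = coset_closedD[OF M]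
  from step.hyps(1) obtain k x where kx: "t \<in> M k" "x \<in> F k" "s = t \<otimes> x"
    unfolding step_def by blast
  have tc: "t \<in> carrier G" and xc: "x \<in> carrier G" using kx cl F_carrier by blast+
  have sk: "s \<in> M k" using kx cl by blast
  \<comment> \<open>a path that stays at its first vertex is either empty or a single step\<close>
  have end_in_coset: ?case if y: "y \<in> F k" "t' = t \<otimes> y" for y
    using zigzag.single[of t M k y, OF kx(1)] y by (cases "y \<in> A") auto
  from step.IH show ?case
  proof (elim disjE exE bexE)
    fix a assume a: "a \<in> A" "t' = s \<otimes> a"
    show ?thesis
      using end_in_coset[of "x \<otimes> a"] a kx tc xc A_carrier A_F F_mult by (auto simp: m_assoc)
  next
    fix i assume z: "zigzag M i s t'"
    show ?thesis
    proof (cases "i = k")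
      case False
      show ?thesis
      proof (cases "x \<in> A")
        case True
        have "t = s \<otimes> inv x" using kx(3) tc xc by (simp add: m_assoc)
        then show ?thesis using zigzag_absorb[OF M z A_inv[OF True]] by auto
      next
        case xA: False
        then show ?thesis using zigzag.cons[of t M k x i t', OF kx(1)] kx z False by auto
      qed
    next
      case True
      from z show ?thesis
      proof cases
        case (single y)
        then show ?thesis
          using end_in_coset[of "x \<otimes> y"] kx tc xc True F_carrier[of y] F_mult
          by (auto simp: m_assoc)
      next
        case (cons y j)
        have yk: "y \<in> F k" "y \<in> carrier G" using cons True F_carrier by auto
        have eq: "s \<otimes> y = t \<otimes> (x \<otimes> y)" using kx(3) tc xc yk by (simp add: m_assoc)
        show ?thesis
        proof (cases "x \<otimes> y \<in> A")
          case xy: True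
          have "t = s \<otimes> y \<otimes> inv (x \<otimes> y)" using eq tc xc yk by (simp add: m_assoc del: inv_mult_group)
          then show ?thesis using zigzag_absorb[OF M cons(3) A_inv[OF xy]] by auto
        next
          case xy: False
          then show ?thesis
            using zigzag.cons[of t M k "x \<otimes> y" j t', OF kx(1)] cons yk kx(2) F_mult eq True by auto
        qed
      qed
    qed
  qed
qed

end

text \<open>The assumption \<open>zigzag_neq\<close> says that the graph of cosets has no circuits, so that it is a
tree; \<open>H\<close> acts on it by left multiplication.\<close>

locale tree_action = factor_subgroups G F A
  for G :: "('g, 'm) monoid_scheme" (structure) and F and A +
  fixes H :: "'g set"
  assumes zigzag_neq: "\<And>i t t'. zigzag (\<lambda>_. carrier G) i t t' \<Longrightarrow> t \<noteq> t'"
    and H_sub: "subgroup H G"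
begin

text \<open>The elements \<open>g\<close> for which the edge \<open>g \<otimes> A\<close> has to be connected with the base
edge \<open>A\<close>.  The subgroup \<open>H\<close> is included for the sake of the empty family, which is
then a subtree only if \<open>H\<close> is trivial; this matches a graph consisting of its base point alone.\<close>

definition span :: "(factor \<Rightarrow> 'g set) \<Rightarrow> 'g set" where
  "span M = H \<union> (\<Union>i. M i)"

definition subtree :: "(factor \<Rightarrow> 'g set) \<Rightarrow> bool" where
  "subtree M \<longleftrightarrow> coset_closed M \<and> (\<forall>i. \<forall>h\<in>H. \<forall>g\<in>M i. h \<otimes> g \<in> M i) \<and>
    (\<forall>g\<in>span M. (step M)\<^sup>*\<^sup>* \<one> g)"

text \<open>The orbit under \<open>H\<close> of the tree vertex \<open>g \<otimes> F i\<close>, as a union of cosets.\<close>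

definition orbit :: "factor \<Rightarrow> 'g \<Rightarrow> 'g set" where
  "orbit i g = {h \<otimes> g \<otimes> x | h x. h \<in> H \<and> x \<in> F i}"

definition finitely_many_orbits :: "(factor \<Rightarrow> 'g set) \<Rightarrow> bool" where
  "finitely_many_orbits M \<longleftrightarrow> (\<forall>i. finite (orbit i ` M i))"

text \<open>The translation of the conditions on a reduced precover.  The first clause excludes a redundant
component that is the whole graph.  The second considers a leaf of the subtree, attached along the edge of
\<open>t\<close>: some translate of this leaf must lie at the base edge, and the stabiliser of the leaf must be
nontrivial if the base edge also has an end of the other kind in the subtree.  The third is the condition
on the components at the base point; as \<open>A\<close> lies in both factors, the intersections with \<open>A\<close> of the groups of these components both
equal \<open>H \<inter> A\<close>.\<close>

definition tight :: "(factor \<Rightarrow> 'g set) \<Rightarrow> bool" where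
  "tight M \<longleftrightarrow>
    (\<forall>i. M i \<noteq> {} \<and> M (other i) = {} \<longrightarrow> H \<noteq> {\<one>}) \<and>
    (\<forall>i t. t \<in> M i \<inter> M (other i) \<and> (\<forall>y\<in>F i. t \<otimes> y \<in> M (other i) \<longrightarrow> y \<in> A) \<longrightarrow>
      \<one> \<in> orbit i t \<and> \<not> (\<one> \<in> M (other i) \<and> (\<forall>h\<in>H. \<forall>y\<in>F i. h \<otimes> t = t \<otimes> y \<longrightarrow> h = \<one>))) \<and>
    (\<forall>i. \<one> \<in> M i \<and> H \<inter> A \<noteq> {\<one>} \<longrightarrow> \<one> \<in> M (other i))"

lemma H_carrier: "h \<in> H \<Longrightarrow> h \<in> carrier G"
  using H_sub subgroup.mem_carrier by metis

lemma H_one: "\<one> \<in> H" using H_sub subgroup.one_closed by metis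
lemma H_mult: "x \<in> H \<Longrightarrow> y \<in> H \<Longrightarrow> x \<otimes> y \<in> H" using H_sub subgroup.m_closed by metis
lemma H_inv: "x \<in> H \<Longrightarrow> inv x \<in> H" using H_sub subgroup.m_inv_closed by metis

lemma subtreeD:
  assumes "subtree M"
  shows "coset_closed M" "g \<in> M i \<Longrightarrow> g \<in> carrier G" "g \<in> M i \<Longrightarrow> x \<in> F i \<Longrightarrow> g \<otimes> x \<in> M i"
    "g \<in> M i \<Longrightarrow> h \<in> H \<Longrightarrow> h \<otimes> g \<in> M i" "g \<in> span M \<Longrightarrow> (step M)\<^sup>*\<^sup>* \<one> g"
  using assms coset_closedD unfolding subtree_def by blast+

lemma span_carrier: "subtree M \<Longrightarrow> g \<in> span M \<Longrightarrow> g \<in> carrier G"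
  using subtreeD(2) H_carrier unfolding span_def by blast

lemma span_H_mult: "subtree M \<Longrightarrow> h \<in> H \<Longrightarrow> g \<in> span M \<Longrightarrow> h \<otimes> g \<in> span M"
  by (auto simp: span_def intro: H_mult subtreeD(4))

lemma span_one: "\<one> \<in> span M"
  using H_one unfolding span_def by blast

text \<open>If a subtree contains two different edges at a vertex of the tree, it contains that vertex:
otherwise a reduced path in the subtree from the one edge to the other closes up to a circuit.\<close>

lemma subtree_convex:
  assumes M: "subtree M" and t: "t \<in> span M" "t \<otimes> y \<in> span M" and y: "y \<in> F i - A"
  shows "t \<in> M i"
proof (rule ccontr)
  assume n: "t \<notin> M i"
  have tc: "t \<in> carrier G" and yc: "y \<in> carrier G"
    using span_carrier[OF M t(1)] y F_carrier by auto
  have "(step M)\<^sup>*\<^sup>* t (t \<otimes> y)"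
    using subtreeD(5)[OF M] t step_sym[OF subtreeD(1)[OF M]] by (meson rtranclp_trans)
  then consider a where "a \<in> A" "t \<otimes> y = t \<otimes> a" | k where "zigzag M k t (t \<otimes> y)"
    using steps_zigzag[OF subtreeD(1)[OF M]] tc yc by blast
  then show False
  proof cases
    case 1
    then show False using y tc yc A_carrier by auto
  next
    case 2
    have "k \<noteq> i" using zigzag_start[OF 2] n by blast
    have "zigzag (\<lambda>_. carrier G) k t (t \<otimes> y)"
      by (rule zigzag_mono[OF 2]) (use subtreeD(2)[OF M] in auto)
    moreover have "t \<otimes> y \<otimes> inv y = t" using tc yc by (simp add: m_assoc)
    ultimately have "zigzag (\<lambda>_. carrier G) i (t \<otimes> y) (t \<otimes> y)"
      using zigzag.cons[of "t \<otimes> y" "\<lambda>_. carrier G" i "inv y" k "t \<otimes> y"] F_A_inv[OF y] \<open>k \<noteq> i\<close> tc yc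
      by simp
    then show False using zigzag_neq by blast
  qed
qed

lemma orbit_self: "g \<in> carrier G \<Longrightarrow> g \<in> orbit i g"
  unfolding orbit_def using H_one F_one by force

lemma orbit_subset: "subtree M \<Longrightarrow> g \<in> M i \<Longrightarrow> orbit i g \<subseteq> M i"
  unfolding orbit_def using subtreeD(3,4) by blast

lemma subtree_insert_orbit:
  assumes M: "subtree M" and g: "g \<in> span M"
  shows "subtree (M(i := M i \<union> orbit i g))" (is "subtree ?N")
proof -
  have gc: "g \<in> carrier G" using span_carrier[OF M g] .
  have le: "M k \<subseteq> ?N k" for k by simp
  have orb_right: "u \<otimes> x \<in> orbit i g" if "u \<in> orbit i g" "x \<in> F i" for u x
  proof -
    from that obtain h y where "h \<in> H" "y \<in> F i" "u = h \<otimes> g \<otimes> y" unfolding orbit_def by blast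
    moreover from this have "u \<otimes> x = h \<otimes> g \<otimes> (y \<otimes> x)"
      using gc that H_carrier F_carrier by (simp add: m_assoc)
    ultimately show ?thesis unfolding orbit_def using F_mult that by blast
  qed
  have orb_left: "k \<otimes> u \<in> orbit i g" if "u \<in> orbit i g" "k \<in> H" for u k
  proof -
    from that obtain h y where "h \<in> H" "y \<in> F i" "u = h \<otimes> g \<otimes> y" unfolding orbit_def by blast
    moreover from this have "k \<otimes> u = (k \<otimes> h) \<otimes> g \<otimes> y"
      using gc that H_carrier F_carrier by (simp add: m_assoc)
    ultimately show ?thesis unfolding orbit_def using H_mult that by blast
  qed
  have orb_carrier: "orbit i g \<subseteq> carrier G"
    unfolding orbit_def using gc H_carrier F_carrier by auto
  have "coset_closed ?N"
    using subtreeD(2,3)[OF M] orb_right orb_carrier unfolding coset_closed_def by auto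
  moreover have "h \<otimes> u \<in> ?N k" if "h \<in> H" "u \<in> ?N k" for h u k
    using that subtreeD(4)[OF M] orb_left by (auto split: if_splits)
  moreover have "(step ?N)\<^sup>*\<^sup>* \<one> u" if "u \<in> span ?N" for u
  proof (cases "u \<in> span M")
    case True
    then show ?thesis using subtreeD(5)[OF M True] step_mono[of M \<one> u ?N] le by blast
  next
    case False
    then have "u \<in> orbit i g" using that by (auto simp: span_def split: if_splits)
    then obtain h y where u: "h \<in> H" "y \<in> F i" "u = h \<otimes> g \<otimes> y" unfolding orbit_def by blast
    have "(step M)\<^sup>*\<^sup>* \<one> (h \<otimes> g)"
      using subtreeD(5)[OF M span_H_mult[OF M u(1) g]] .
    then have "(step ?N)\<^sup>*\<^sup>* \<one> (h \<otimes> g)" using step_mono[of M _ _ ?N] le by blast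
    moreover have "step ?N (h \<otimes> g) u"
      unfolding step_def using u orb_left[OF orbit_self[OF gc] u(1)] by auto
    ultimately show ?thesis by (rule rtranclp.rtrancl_into_rtrancl)
  qed
  ultimately show ?thesis unfolding subtree_def by blast
qed

lemma subtree_Un:
  assumes M: "subtree M" and N: "subtree N"
  shows "subtree (\<lambda>i. M i \<union> N i)" (is "subtree ?U")
proof -
  have "(step ?U)\<^sup>*\<^sup>* \<one> u" if "u \<in> span ?U" for u
  proof -
    have "u \<in> span M \<or> u \<in> span N" using that by (auto simp: span_def)
    then show ?thesis
      using subtreeD(5)[OF M] subtreeD(5)[OF N] step_mono[of M \<one> u ?U] step_mono[of N \<one> u ?U] by blast
  qed
  then show ?thesis
    using M N unfolding subtree_def coset_closed_def by blast
qed

text \<open>A subtree is the union of the vertex orbits that it contains.\<close>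

lemma finite_subtrees:
  assumes "finitely_many_orbits U"
  shows "finite {M. subtree M \<and> M \<le> U}" (is "finite ?S")
proof (rule finite_imageD)
  let ?f = "\<lambda>M. (M F1, M F2)"
  let ?B = "\<lambda>i. Union ` Pow (orbit i ` U i)"
  have "M i \<in> ?B i" if tr: "subtree M" "M \<le> U" for M i
  proof -
    have "orbit i g \<subseteq> M i" "g \<in> orbit i g" if g: "g \<in> M i" for g
      using orbit_subset[OF tr(1), of g i] orbit_self[OF subtreeD(2)[OF tr(1), of g i], of i] g by auto
    then have "M i = \<Union> (orbit i ` M i)" by blast
    moreover have "orbit i ` M i \<in> Pow (orbit i ` U i)"
      using tr(2) by (auto simp: le_fun_def)
    ultimately show ?thesis by blast
  qed
  then have sub: "?f ` ?S \<subseteq> ?B F1 \<times> ?B F2" by blast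
  have "finite (?B i)" for i using assms by (simp add: finitely_many_orbits_def)
  then show "finite (?f ` ?S)" by (intro finite_subset[OF sub] finite_cartesian_product)
  show "inj_on ?f ?S"
    by (intro inj_onI ext) (rename_tac M N i, case_tac i, auto)
qed

text \<open>A proper subtree of \<open>U\<close> misses a vertex of \<open>U\<close> that is adjacent to it, since
\<open>U\<close> is connected and both contain the base edge.\<close>

lemma frontier:
  assumes M: "subtree M" and U: "subtree U" and le: "M \<le> U" and ne: "M \<noteq> U"
  shows "\<exists>i g. g \<in> span M \<and> g \<in> U i \<and> g \<notin> M i"
proof (rule ccontr)
  assume "\<not> ?thesis"
  then have cl: "g \<in> M i" if "g \<in> span M" "g \<in> U i" for g i using that by blast
  have reach: "(step U)\<^sup>*\<^sup>* \<one> u \<Longrightarrow> u \<in> span M" for u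
  proof (induction rule: rtranclp_induct)
    case base
    then show ?case by (rule span_one)
  next
    case (step u u')
    then obtain i x where "u \<in> U i" "x \<in> F i" "u' = u \<otimes> x" unfolding step_def by blast
    then have "u' \<in> M i" using cl[OF step.IH] subtreeD(3)[OF M] by blast
    then show ?case by (auto simp: span_def)
  qed
  have "U i \<subseteq> M i" for i
  proof
    fix u assume u: "u \<in> U i"
    then have "u \<in> span U" by (auto simp: span_def)
    then show "u \<in> M i" using cl[OF reach[OF subtreeD(5)[OF U]] u] by blast
  qed
  then have "U \<le> M" by (simp add: le_fun_def)
  then show False using le ne by simp
qed

text \<open>If a subtree has finite quotient, it can be built from any subtree inside it by attaching vertex
orbits one at a time; this isolates the last one.\<close>

lemma last_orbit:
  assumes M: "subtree M" and U: "subtree U" and le: "M \<le> U" "M \<noteq> U" and fin: "finitely_many_orbits U"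
  obtains M' i g where "subtree M'" "M \<le> M'" "g \<in> span M'" "g \<notin> M' i"
    "U = M'(i := M' i \<union> orbit i g)"
proof -
  let ?S = "{M'. subtree M' \<and> M \<le> M' \<and> M' \<le> U \<and> M' \<noteq> U}"
  have "finite ?S" using finite_subset[OF _ finite_subtrees[OF fin], of ?S] by blast
  moreover have "?S \<noteq> {}" using M le by blast
  ultimately have "\<exists>M'\<in>?S. \<forall>N\<in>?S. M' \<le> N \<longrightarrow> M' = N" by (rule finite_has_maximal)
  then obtain M' where M': "M' \<in> ?S" and max: "\<And>N. N \<in> ?S \<Longrightarrow> M' \<le> N \<Longrightarrow> M' = N"
    by blast
  obtain i g where g: "g \<in> span M'" "g \<in> U i" "g \<notin> M' i"
    using frontier[of M' U] M' U by blast
  let ?N = "M'(i := M' i \<union> orbit i g)"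
  have N: "subtree ?N" using subtree_insert_orbit g(1) M' by blast
  have "?N \<le> U"
    using M' orbit_subset[OF U g(2)] by (auto simp: le_fun_def)
  moreover have "M' \<le> ?N" by (auto simp: le_fun_def)
  moreover have "g \<in> ?N i" using orbit_self[of g i] subtreeD(2)[OF U g(2)] by simp
  then have "M' \<noteq> ?N" using g(3) by (metis)
  moreover have "M \<le> ?N" using M' \<open>M' \<le> ?N\<close> by (blast intro: order_trans)
  ultimately have "?N = U" using max[of ?N] N by blast
  then show thesis using that M' g by blast
qed

text \<open>A path can leave a vertex of the tree only along an edge that leads to a vertex of the other kind.\<close>

lemma steps_stay_in_coset:
  assumes N: "subtree N" and s: "(step N)\<^sup>*\<^sup>* u v" and u: "u \<in> carrier G"
    and no: "\<not> (\<exists>x\<in>F i. u \<otimes> x \<in> N (other i))"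
  shows "\<exists>x\<in>F i. v = u \<otimes> x"
  using s
proof (induction rule: rtranclp_induct)
  case base
  then show ?case using u F_one by force
next
  case (step v w)
  then obtain x k y where x: "x \<in> F i" "v = u \<otimes> x" and y: "v \<in> N k" "y \<in> F k" "w = v \<otimes> y"
    unfolding step_def by blast
  then have "k = i" using no neq_iff_other by metis
  then have "x \<otimes> y \<in> F i" "w = u \<otimes> (x \<otimes> y)"
    using x y u F_mult F_carrier by (auto simp: m_assoc)
  then show ?case by blast
qed

text \<open>The vertex orbit attached last to \<open>M\<close> in order to obtain \<open>M \<union> N\<close> is an orbit of
leaves, which a tight subtree \<open>N\<close> can only have at the base edge, and there only with a
nontrivial stabiliser.  The stabiliser of such a leaf lies in \<open>H \<inter> A\<close>, and then the third clause
of tightness says that \<open>M\<close> contains both ends of the base edge, hence the leaf.\<close>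

theorem tight_subtree_le:
  assumes M: "subtree M" "tight M" and N: "subtree N" "tight N" "finitely_many_orbits N"
    and finM: "finitely_many_orbits M"
  shows "N \<le> M"
proof (rule ccontr)
  assume nle: "\<not> N \<le> M"
  let ?U = "\<lambda>i. M i \<union> N i"
  have "finitely_many_orbits ?U" using N(3) finM by (simp add: finitely_many_orbits_def image_Un)
  moreover have "M \<le> ?U" by (simp add: le_fun_def)
  moreover have "M \<noteq> ?U" using nle by (metis Un_upper2 le_funI)
  ultimately obtain M' i g where M': "subtree M'" "M \<le> M'" "g \<in> span M'" "g \<notin> M' i"
    and U: "?U = M'(i := M' i \<union> orbit i g)"
    using last_orbit[OF M(1) subtree_Un[OF M(1) N(1)]] by metis
  let ?j = "other i"
  have gc: "g \<in> carrier G" using span_carrier[OF M'(1,3)] .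
  have Nj: "N ?j \<subseteq> M' ?j" using fun_cong[OF U, of ?j] by auto
  have gN: "g \<in> N i"
    using fun_cong[OF U, of i] orbit_self[OF gc, of i] M'(2,4) by (auto simp: le_fun_def)
  have notM': "g \<otimes> x \<notin> M' i" if "x \<in> F i" for x
    using subtreeD(3)[OF M'(1), of "g \<otimes> x" i "inv x"] that M'(4) gc F_carrier[OF that] F_inv[OF that]
    by (auto simp: m_assoc)
  \<comment> \<open>the vertex \<open>g \<otimes> F i\<close> does not belong to \<open>M'\<close>, so by convexity it is joined to
    \<open>M'\<close> by a single edge\<close>
  have unique: "y \<in> A" if "x \<in> F i" "g \<otimes> x \<in> span M'" "y \<in> F i" "g \<otimes> x \<otimes> y \<in> span M'" for x y
    using subtree_convex[OF M'(1) that(2,4)] notM'[OF that(1)] that(3) by blast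
  have orbitN: "orbit i g \<subseteq> N i" using orbit_subset[OF N(1) gN] .
  note R1 = N(2)[unfolded tight_def, THEN conjunct1, rule_format]
  note R2 = N(2)[unfolded tight_def, THEN conjunct2, THEN conjunct1, rule_format]
  note R3 = M(2)[unfolded tight_def, THEN conjunct2, THEN conjunct2, rule_format]
  show False
  proof (cases "\<one> \<in> orbit i g")
    case True
    then obtain h x where hx: "h \<in> H" "x \<in> F i" "\<one> = h \<otimes> g \<otimes> x" unfolding orbit_def by blast
    have hxc: "h \<in> carrier G" "x \<in> carrier G" using hx H_carrier F_carrier by blast+
    have gx: "g \<otimes> x = inv h" using hx(3) hxc gc by (metis inv_equality inv_inv m_assoc m_closed)
    have oneN: "\<one> \<in> N i" using True orbitN by blast
    have one_notM': "\<one> \<notin> M' i"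
      using notM'[OF hx(2)] subtreeD(4)[OF M'(1), of \<one> i "inv h"] H_inv[OF hx(1)] hxc gx by auto
    have unique1: "y \<in> A" if "y \<in> F i" "y \<in> span M'" for y
      using subtree_convex[OF M'(1) span_one, of y i] that one_notM' F_carrier by auto
    have HA: "H \<inter> F i \<subseteq> A" using unique1 by (auto simp: span_def)
    \<comment> \<open>otherwise \<open>H \<inter> A\<close> is nontrivial, and since the base edge has an end in \<open>M\<close>, tightness of
      \<open>M\<close> puts its other end, which is the new vertex, into \<open>M\<close>\<close>
    have triv: "H \<inter> F i = {\<one>}"
    proof (rule ccontr)
      assume "H \<inter> F i \<noteq> {\<one>}"
      then have ne: "H \<inter> A \<noteq> {\<one>}" using HA A_le by blast
      \<comment> \<open>if \<open>M\<close> had no vertex at the base edge it would be empty, but then no nontrivial element of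
        \<open>H\<close> is reachable in it\<close>
      have "\<one> \<in> M ?j"
      proof (rule ccontr)
        assume "\<one> \<notin> M ?j"
        moreover have "\<one> \<notin> M i" using one_notM' M'(2) by (auto simp: le_fun_def)
        ultimately have none: "\<one> \<notin> M k" for k using neq_iff_other by metis
        obtain k where k: "k \<in> H" "k \<noteq> \<one>" using ne H_one A_one by blast
        have "(step M)\<^sup>*\<^sup>* \<one> k" using subtreeD(5)[OF M(1)] k by (auto simp: span_def)
        then obtain u where "step M \<one> u" using k(2) by (metis converse_rtranclpE)
        then show False using none unfolding step_def by blast
      qed
      then have "\<one> \<in> M i" using R3[of ?j] ne by (metis neq_iff_other other_neq(1))
      then show False using one_notM' M'(2) by (auto simp: le_fun_def)
    qed
    show False
    \<comment> \<open>up to translation by \<open>H\<close> the new vertex is \<open>F i\<close>: it is the only vertex of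
      \<open>N\<close>, against the first clause of tightness, or a leaf attached along the base edge, against the
      second\<close>
    proof (cases "\<exists>y\<in>F i. y \<in> N ?j")
      case False
      have "u \<in> F i" if "u \<in> span N" for u
        using steps_stay_in_coset[OF N(1) subtreeD(5)[OF N(1) that], of i] False F_carrier by auto
      then have "H \<subseteq> F i" "N ?j \<subseteq> F i" unfolding span_def by blast+
      then have "H = {\<one>}" "N ?j = {}" using triv False by blast+
      then show False using R1[of i] gN by blast
    next
      case True
      then obtain y where y: "y \<in> F i" "y \<in> N ?j" by blast
      have inA: "y \<in> A" if "y \<in> F i" "y \<in> N ?j" for y
        using unique1 that Nj by (auto simp: span_def)
      have "y \<otimes> inv y \<in> N ?j"
        using subtreeD(3)[OF N(1) y(2)] A_F[OF A_inv[OF inA[OF y]]] by blast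
      then have "\<one> \<in> N ?j" using F_carrier[OF y(1)] by simp
      then show False
        using R2[of \<one> i] oneN inA triv F_carrier H_carrier by fastforce
    qed
  next
    case False
    have "(step N)\<^sup>*\<^sup>* g \<one>"
      using subtreeD(5)[OF N(1), of g] step_sym[OF subtreeD(1)[OF N(1)]] gN by (auto simp: span_def)
    moreover have "\<one> \<noteq> g \<otimes> x" if "x \<in> F i" for x
    proof
      assume "\<one> = g \<otimes> x"
      then have "\<one> = \<one> \<otimes> g \<otimes> x" using l_one[OF gc] by metis
      then show False using False H_one that unfolding orbit_def by blast
    qed
    ultimately obtain x where x: "x \<in> F i" "g \<otimes> x \<in> N ?j"
      using steps_stay_in_coset[OF N(1) _ gc, of \<one> i] by blast
    have xc: "x \<in> carrier G" using F_carrier[OF x(1)] .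
    have "y \<in> A" if "y \<in> F i" "g \<otimes> x \<otimes> y \<in> N ?j" for y
      using unique[OF x(1) _ that(1)] x(2) that(2) Nj unfolding span_def by blast
    then have "\<one> \<in> orbit i (g \<otimes> x)"
      using R2[of "g \<otimes> x" i] subtreeD(3)[OF N(1) gN x(1)] x(2) by blast
    then obtain h y where hy: "h \<in> H" "y \<in> F i" "\<one> = h \<otimes> (g \<otimes> x) \<otimes> y"
      unfolding orbit_def by blast
    then have "\<one> = h \<otimes> g \<otimes> (x \<otimes> y)"
      using gc xc H_carrier F_carrier by (simp add: m_assoc)
    then show False using False hy F_mult[OF x(1) hy(2)] unfolding orbit_def by blast
  qed
qed

end

section \<open>The amalgam of two presented groups\<close>

lemma word_class_closed: "w \<in> words X \<Longrightarrow> word_class X R w \<in> carrier (presented_group X R)"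
  by (simp add: presented_group_def)

lemma carrier_presented_groupE:
  assumes "g \<in> carrier (presented_group X R)"
  obtains w where "w \<in> words X" "g = word_class X R w"
  using assms by (auto simp: presented_group_def)

lemma one_presented_group: "\<one>\<^bsub>presented_group X R\<^esub> = word_class X R []"
  by (simp add: presented_group_def)

lemma inv_word_class:
  assumes "w \<in> words X"
  shows "inv\<^bsub>presented_group X R\<^esub> word_class X R w = word_class X R (inv_word w)"
proof -
  interpret group "presented_group X R" by (rule group_presented_group)
  have "word_class X R (inv_word w) \<otimes>\<^bsub>presented_group X R\<^esub> word_class X R w = word_class X R []"
    using assms inv_word_left[OF assms, of R]
    by (simp add: presented_group_mult inv_word_words append_words word_class_eq_iff)
  then show ?thesis
    using assms by (intro inv_equality) (auto simp: one_presented_group word_class_closed inv_word_words)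
qed

lemma Nil_words [simp]: "[] \<in> words X"
  by (simp add: words_def)

lemma Cons_words: "l # w \<in> words X \<longleftrightarrow> l \<in> letters X \<and> w \<in> words X"
  by (auto simp: words_def)

lemma append_words_iff: "u @ v \<in> words X \<longleftrightarrow> u \<in> words X \<and> v \<in> words X"
  by (auto simp: words_def)

lemma inv_letter_letters: "inv_letter l \<in> letters X \<longleftrightarrow> l \<in> letters X"
  by (cases l) (auto simp: letters_def)

lemma words_mono: "X \<subseteq> Y \<Longrightarrow> words X \<subseteq> words Y"
  by (auto simp: words_def letters_def)

definition factor_image :: "('x, 'a) amalgam_data \<Rightarrow> factor \<Rightarrow> 'x word set set" where
  "factor_image D i = element D ` words (gens D i)"

locale presented_amalgam =
  fixes D :: "('x, 'a) amalgam_data"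
  assumes amalgam: "amalgam D"
begin

abbreviation cls :: "factor \<Rightarrow> 'x word \<Rightarrow> 'x word set" where
  "cls i \<equiv> word_class (gens D i) (rels D i)"

sublocale group "amalgam_group D"
  unfolding amalgam_group_def by (rule group_presented_group)

sublocale pair: amalgamated_pair "amal D" "factor_group D" "emb D"
  using amalgam
  by (intro amalgamated_pair.intro) (auto simp: amalgam_def factor_group_def group_presented_group)

lemma gens_words: "w \<in> words (gens D i) \<Longrightarrow> w \<in> words (all_gens D)"
  using words_mono[of "gens D i" "all_gens D"] by (cases i) (auto simp: all_gens_def)

lemma element_closed: "w \<in> words (all_gens D) \<Longrightarrow> element D w \<in> carrier (amalgam_group D)"
  by (simp add: element_def amalgam_group_def word_class_closed)

lemma element_Nil: "element D [] = \<one>\<^bsub>amalgam_group D\<^esub>"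
  by (simp add: element_def amalgam_group_def one_presented_group)

lemma element_append:
  "u \<in> words (all_gens D) \<Longrightarrow> v \<in> words (all_gens D) \<Longrightarrow>
    element D (u @ v) = element D u \<otimes>\<^bsub>amalgam_group D\<^esub> element D v"
  by (simp add: element_def amalgam_group_def presented_group_mult)

lemma element_inv:
  "w \<in> words (all_gens D) \<Longrightarrow> element D (inv_word w) = inv\<^bsub>amalgam_group D\<^esub> element D w"
  by (simp add: element_def amalgam_group_def inv_word_class)

lemma element_eq_iff:
  "u \<in> words (all_gens D) \<Longrightarrow> element D u = element D v \<longleftrightarrow> word_eq (all_gens D) (all_rels D) u v"
  by (simp add: element_def word_class_eq_iff)

lemma cls_closed: "w \<in> words (gens D i) \<Longrightarrow> cls i w \<in> carrier (factor_group D i)"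
  by (simp add: factor_group_def word_class_closed)

lemma cls_append:
  "u \<in> words (gens D i) \<Longrightarrow> v \<in> words (gens D i) \<Longrightarrow>
    cls i (u @ v) = cls i u \<otimes>\<^bsub>factor_group D i\<^esub> cls i v"
  by (simp add: factor_group_def presented_group_mult)

lemma cls_Nil: "cls i [] = \<one>\<^bsub>factor_group D i\<^esub>"
  by (simp add: factor_group_def one_presented_group)

lemma cls_inv:
  "w \<in> words (gens D i) \<Longrightarrow> cls i (inv_word w) = inv\<^bsub>factor_group D i\<^esub> cls i w"
  by (simp add: factor_group_def inv_word_class)

lemma word_eq_all:
  "word_eq (gens D i) (rels D i) u v \<Longrightarrow> word_eq (all_gens D) (all_rels D) u v"
proof (induction rule: word_eq.induct)
  case (refl w)
  then show ?case by (blast intro: word_eq.refl gens_words)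
next
  case (sym u v)
  then show ?case by (blast intro: word_eq.sym)
next
  case (trans u v w)
  then show ?case by (blast intro: word_eq.trans)
next
  case (cancel u v l)
  then have "l \<in> letters (all_gens D)" using gens_words[of "[l]"] by (simp add: Cons_words)
  then show ?case using cancel by (blast intro: word_eq.cancel gens_words)
next
  case (relator u v r)
  then have "r \<in> all_rels D" by (cases i) (auto simp: all_rels_def)
  then show ?case using relator by (blast intro: word_eq.relator gens_words)
qed

lemma element_eq_of_cls_eq:
  assumes "u \<in> words (gens D i)" "cls i u = cls i v"
  shows "element D u = element D v"
  using assms word_eq_all[of i u v] gens_words[OF assms(1)]
  by (simp add: word_class_eq_iff element_eq_iff)

lemma represents_exists: "a \<in> carrier (amal D) \<Longrightarrow> \<exists>u. represents D i u a"
  using pair.emb.hom_closed[of a i] unfolding factor_group_def represents_def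
  by (metis carrier_presented_groupE)

lemma represents_words: "represents D i u a \<Longrightarrow> u \<in> words (gens D i)"
  by (simp add: represents_def)

lemma represents_F1_F2:
  assumes "represents D F1 u a" "represents D F2 v a"
  shows "element D u = element D v"
proof -
  let ?r = "u @ inv_word v"
  have w: "u \<in> words (all_gens D)" "v \<in> words (all_gens D)"
    using assms represents_words gens_words by blast+
  have "?r \<in> all_rels D" using assms unfolding all_rels_def by blast
  then have "word_eq (all_gens D) (all_rels D) ([] @ ?r @ []) ([] @ [])"
    using w by (intro word_eq.relator) (auto simp: append_words_iff inv_word_words)
  then have "element D ?r = element D []"
    using w by (simp add: element_eq_iff append_words_iff inv_word_words)
  then have "element D u \<otimes>\<^bsub>amalgam_group D\<^esub> inv\<^bsub>amalgam_group D\<^esub> element D v = \<one>\<^bsub>amalgam_group D\<^esub>"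
    using w by (simp add: element_append element_inv element_Nil inv_word_words)
  then show ?thesis using w by (metis element_closed inv_solve_right' l_one one_closed)
qed

text \<open>The image in the amalgam of an element of \<open>A\<close> can be computed through either factor, and with
any representing word.\<close>

lemma represents_element_eq:
  assumes "represents D i u a" "represents D k v a"
  shows "element D u = element D v"
proof (cases "i = k")
  case True
  then have "cls i u = cls i v" using assms by (simp add: represents_def)
  then show ?thesis using element_eq_of_cls_eq represents_words[OF assms(1)] by blast
next
  case False
  then show ?thesis using assms represents_F1_F2 by (cases i; cases k) metis+
qed

lemma amal_imageI:
  assumes "represents D i u a"
  shows "element D u \<in> amal_image D"
proof -
  obtain v where "represents D F1 v a"
    using assms represents_exists[of a F1] by (auto simp: represents_def)
  then show ?thesis
    unfolding amal_image_def using represents_element_eq[OF assms] by blast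
qed

lemma amal_imageE:
  assumes "g \<in> amal_image D"
  obtains u a where "represents D i u a" "g = element D u"
proof -
  from assms obtain v a where v: "represents D F1 v a" "g = element D v"
    unfolding amal_image_def by blast
  then obtain u where "represents D i u a"
    using represents_exists[of a i] by (auto simp: represents_def)
  then show thesis using that v represents_element_eq by metis
qed

lemma represents_append:
  assumes "represents D i u a" "represents D i v b"
  shows "represents D i (u @ v) (a \<otimes>\<^bsub>amal D\<^esub> b)"
  using assms by (simp add: represents_def append_words cls_append)

lemma represents_inv:
  assumes "represents D i u a"
  shows "represents D i (inv_word u) (inv\<^bsub>amal D\<^esub> a)"
  using assms by (simp add: represents_def inv_word_words cls_inv)

lemma represents_Nil: "represents D i [] \<one>\<^bsub>amal D\<^esub>"
  by (simp add: represents_def cls_Nil)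

sublocale factor_subgroups "amalgam_group D" "factor_image D" "amal_image D"
proof (intro factor_subgroups.intro factor_subgroups_axioms.intro)
  show "Group.group (amalgam_group D)" by (rule is_group)
  show "subgroup (factor_image D i) (amalgam_group D)" for i
  proof (rule subgroupI)
    show "factor_image D i \<subseteq> carrier (amalgam_group D)"
      using gens_words element_closed by (auto simp: factor_image_def)
    show "factor_image D i \<noteq> {}" by (auto simp: factor_image_def intro: Nil_words)
    show "inv\<^bsub>amalgam_group D\<^esub> g \<in> factor_image D i" if "g \<in> factor_image D i" for g
    proof -
      from that obtain w where w: "w \<in> words (gens D i)" "g = element D w"
        by (auto simp: factor_image_def)
      then have "inv\<^bsub>amalgam_group D\<^esub> g = element D (inv_word w)"
        using element_inv[OF gens_words[OF w(1)]] by simp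
      then show ?thesis
        using inv_word_words[OF w(1)] unfolding factor_image_def by (rule image_eqI)
    qed
    show "g \<otimes>\<^bsub>amalgam_group D\<^esub> h \<in> factor_image D i"
      if "g \<in> factor_image D i" "h \<in> factor_image D i" for g h
    proof -
      from that obtain u v where uv: "u \<in> words (gens D i)" "v \<in> words (gens D i)"
        "g = element D u" "h = element D v"
        by (auto simp: factor_image_def)
      then have "g \<otimes>\<^bsub>amalgam_group D\<^esub> h = element D (u @ v)"
        using element_append[OF gens_words[OF uv(1)] gens_words[OF uv(2)]] by simp
      then show ?thesis
        using append_words[OF uv(1,2)] unfolding factor_image_def by (rule image_eqI)
    qed
  qed
  show "subgroup (amal_image D) (amalgam_group D)"
  proof (rule subgroupI)
    show "amal_image D \<subseteq> carrier (amalgam_group D)"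
      by (auto elim!: amal_imageE[of _ F1] intro: element_closed gens_words represents_words)
    show "amal_image D \<noteq> {}" using amal_imageI[OF represents_Nil] by blast
    show "inv\<^bsub>amalgam_group D\<^esub> g \<in> amal_image D" if g: "g \<in> amal_image D" for g
    proof -
      from g obtain u a where u: "represents D F1 u a" "g = element D u" by (rule amal_imageE)
      then show ?thesis
        using amal_imageI[OF represents_inv[OF u(1)]] represents_words gens_words element_inv by metis
    qed
    show "g \<otimes>\<^bsub>amalgam_group D\<^esub> h \<in> amal_image D" if g: "g \<in> amal_image D" and h: "h \<in> amal_image D" for g h
    proof -
      from g obtain u a where u: "represents D F1 u a" "g = element D u" by (rule amal_imageE)
      from h obtain v b where v: "represents D F1 v b" "h = element D v" by (rule amal_imageE)
      show ?thesis
        using amal_imageI[OF represents_append[OF u(1) v(1)]] u v represents_words gens_words element_append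
        by metis
    qed
  qed
  show "amal_image D \<subseteq> factor_image D i" for i
    by (auto simp: factor_image_def elim!: amal_imageE[of _ i] intro: represents_words)
qed

text \<open>Only applied to generators of the amalgam, each of which belongs to exactly one factor.\<close>

definition colour :: "'x letter \<Rightarrow> factor" where
  "colour l = (if l \<in> letters (gens D F1) then F1 else F2)"

lemma letters_disjoint: "l \<in> letters (gens D i) \<Longrightarrow> l \<in> letters (gens D k) \<Longrightarrow> i = k"
  using amalgam unfolding amalgam_def by (cases i; cases k) auto

lemma letters_all: "letters (all_gens D) = (\<Union>i. letters (gens D i))"
proof -
  have "l \<in> letters (gens D F1) \<union> letters (gens D F2)" if "l \<in> letters (gens D i)" for l i
    using that by (cases i) auto
  then have "(\<Union>i. letters (gens D i)) = letters (gens D F1) \<union> letters (gens D F2)" by blast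
  then show ?thesis by (auto simp: all_gens_def letters_def)
qed

lemma colour_eq: "l \<in> letters (gens D i) \<Longrightarrow> colour l = i"
  using letters_disjoint[of l i F1] unfolding colour_def by (cases i) auto

definition letter_act where
  "letter_act l = pair.act (colour l) (cls (colour l) [l])"

definition word_act where
  "word_act w \<omega> = foldr letter_act w \<omega>"

lemma word_act_append: "word_act (u @ v) \<omega> = word_act u (word_act v \<omega>)"
  by (simp add: word_act_def)

text \<open>On words of a single factor the action letter by letter is the action of the element of the factor
that they represent.\<close>

lemma word_act_factor:
  assumes "w \<in> words (gens D i)" "\<omega> \<in> pair.forms"
  shows "word_act w \<omega> = pair.act i (cls i w) \<omega>"
  using assms(1)
proof (induction w)
  case Nil
  then show ?case using assms(2) by (simp add: word_act_def cls_Nil pair.act_one)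
next
  case (Cons l w)
  then have lw: "[l] \<in> words (gens D i)" "w \<in> words (gens D i)" "colour l = i"
    using colour_eq by (auto simp: Cons_words)
  then show ?case
    using Cons.IH assms(2) pair.act_mult[of "cls i [l]" i "cls i w" \<omega>] cls_append[of "[l]" i w]
      cls_closed[OF lw(1)] cls_closed[OF lw(2)]
    by (simp add: word_act_def letter_act_def)
qed

lemma word_act_closed:
  assumes "w \<in> words (all_gens D)" "\<omega> \<in> pair.forms"
  shows "word_act w \<omega> \<in> pair.forms"
  using assms(1)
proof (induction w)
  case Nil
  then show ?case using assms(2) by (simp add: word_act_def)
next
  case (Cons l w)
  then obtain i where i: "[l] \<in> words (gens D i)" by (auto simp: Cons_words letters_all)
  have "word_act (l # w) \<omega> = word_act [l] (word_act w \<omega>)"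
    using word_act_append[of "[l]" w] by simp
  then show ?case
    using word_act_factor[OF i] Cons pair.act_closed[OF cls_closed[OF i]] by (simp add: Cons_words)
qed

lemma word_act_eq_Nil:
  assumes "w \<in> words (gens D i)" "cls i w = cls i []" "\<omega> \<in> pair.forms"
  shows "word_act w \<omega> = \<omega>"
  using word_act_factor[OF assms(1,3)] assms by (simp add: cls_Nil pair.act_one)

text \<open>The relators of the factors act trivially because a factor acts as a group, and the relators that
identify the two copies of \<open>A\<close> do so because both factors induce the same action of \<open>A\<close>.\<close>

lemma word_act_relator:
  assumes r: "r \<in> all_rels D" and \<omega>: "\<omega> \<in> pair.forms"
  shows "word_act r \<omega> = \<omega>"
proof -
  have rel: "word_act r \<omega> = \<omega>" if r: "r \<in> rels D i" for i
  proof -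
    have rw: "r \<in> words (gens D i)" using r amalgam unfolding amalgam_def by blast
    have "word_eq (gens D i) (rels D i) ([] @ r @ []) ([] @ [])"
      using r rw by (intro word_eq.relator) auto
    then have "cls i r = cls i []" using rw by (simp add: word_class_eq_iff)
    then show ?thesis using word_act_eq_Nil rw \<omega> by blast
  qed
  have "word_act (u @ inv_word v) \<omega> = \<omega>" if u: "represents D F1 u a" and v: "represents D F2 v a" for u v a
  proof -
    obtain b s where \<omega>': "\<omega> = (b, s)" by fastforce
    have a: "a \<in> carrier (amal D)" and b: "b \<in> carrier (amal D)"
      using u \<omega> \<omega>' by (auto simp: represents_def pair.forms_def)
    note v' = represents_inv[OF v]
    have "word_act (inv_word v) \<omega> = (inv\<^bsub>amal D\<^esub> a \<otimes>\<^bsub>amal D\<^esub> b, s)"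
      using word_act_factor[OF represents_words[OF v'] \<omega>] v' pair.act_emb[of "inv\<^bsub>amal D\<^esub> a" b s F2] \<omega> \<omega>' a
      by (simp add: represents_def)
    moreover have "(inv\<^bsub>amal D\<^esub> a \<otimes>\<^bsub>amal D\<^esub> b, s) \<in> pair.forms"
      using \<omega> \<omega>' a by (simp add: pair.forms_def)
    ultimately show ?thesis
      using word_act_factor[OF represents_words[OF u]] u a b \<omega>'
        pair.act_emb[of a "inv\<^bsub>amal D\<^esub> a \<otimes>\<^bsub>amal D\<^esub> b" s F1]
      by (simp add: word_act_append represents_def pair.A.m_assoc[symmetric])
  qed
  then show ?thesis using r rel unfolding all_rels_def by blast
qed

lemma word_act_cong:
  "word_eq (all_gens D) (all_rels D) u v \<Longrightarrow> \<omega> \<in> pair.forms \<Longrightarrow> word_act u \<omega> = word_act v \<omega>"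
proof (induction rule: word_eq.induct)
  case (cancel u v l)
  then obtain i where l: "l \<in> letters (gens D i)" by (auto simp: letters_all)
  then have w: "[l, inv_letter l] \<in> words (gens D i)" by (simp add: Cons_words inv_letter_letters)
  have "word_eq (gens D i) (rels D i) ([] @ [l, inv_letter l] @ []) ([] @ [])"
    using l by (intro word_eq.cancel) auto
  then have "cls i [l, inv_letter l] = cls i []" using w by (simp add: word_class_eq_iff)
  then have "word_act [l, inv_letter l] (word_act v \<omega>) = word_act v \<omega>"
    using word_act_eq_Nil[OF w] word_act_closed cancel by blast
  then show ?case by (simp only: word_act_append)
next
  case (relator u v r)
  then show ?case using word_act_relator word_act_closed by (simp add: word_act_append)
qed auto

text \<open>Acting on the empty normal form, each step of a path without backtracking puts a new syllable in front,
since it multiplies a form that starts with the other factor by an element outside \<open>A\<close>.\<close>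

lemma zigzag_word:
  "zigzag M i t t' \<Longrightarrow> \<exists>w\<in>words (all_gens D). t' = t \<otimes>\<^bsub>amalgam_group D\<^esub> element D w \<and>
    (\<exists>x s. snd (word_act w (\<one>\<^bsub>amal D\<^esub>, [])) = (i, x) # s)"
  if M: "\<And>i. M i \<subseteq> carrier (amalgam_group D)"
proof -
  let ?\<omega> = "(\<one>\<^bsub>amal D\<^esub>, [])"
  have \<omega>: "?\<omega> \<in> pair.forms" by (simp add: pair.forms_def)
  have ext: "\<exists>v\<in>words (gens D i). y = element D v \<and>
      (\<exists>x. snd (word_act v \<omega>) = (i, x) # snd \<omega>)"
    if y: "y \<in> factor_image D i - amal_image D" and \<omega>: "\<omega> \<in> pair.forms" "pair.avoids i (snd \<omega>)" for y i \<omega>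
  proof -
    obtain v where v: "v \<in> words (gens D i)" "y = element D v"
      using y by (auto simp: factor_image_def)
    have "cls i v \<notin> pair.img i"
    proof
      assume "cls i v \<in> pair.img i"
      then obtain a where "represents D i v a" using v(1) by (auto simp: represents_def)
      then show False using y v amal_imageI by blast
    qed
    then show ?thesis
      using v pair.act_lengthens[OF cls_closed[OF v(1)] _ \<omega>] word_act_factor[OF v(1) \<omega>(1)] by auto
  qed
  show "\<exists>w\<in>words (all_gens D). t' = t \<otimes>\<^bsub>amalgam_group D\<^esub> element D w \<and>
    (\<exists>x s. snd (word_act w ?\<omega>) = (i, x) # s)" if "zigzag M i t t'"
    using that
  proof (induction rule: zigzag.induct)
    case (single t i y)
    then show ?case using ext[OF single(2) \<omega>] gens_words by fastforce
  next
    case (cons t i y k t')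
    then obtain w x s where w: "w \<in> words (all_gens D)"
      "t' = t \<otimes>\<^bsub>amalgam_group D\<^esub> y \<otimes>\<^bsub>amalgam_group D\<^esub> element D w" "snd (word_act w ?\<omega>) = (k, x) # s"
      by blast
    have "pair.avoids i (snd (word_act w ?\<omega>))" using w(3) cons by simp
    then obtain v z where v: "v \<in> words (gens D i)" "y = element D v"
      "snd (word_act v (word_act w ?\<omega>)) = (i, z) # snd (word_act w ?\<omega>)"
      using ext[OF cons(2) word_act_closed[OF w(1) \<omega>]] by blast
    have "t \<in> carrier (amalgam_group D)" using M cons by blast
    then have "t' = t \<otimes>\<^bsub>amalgam_group D\<^esub> element D (v @ w)"
      using w v by (simp add: element_append gens_words m_assoc element_closed)
    then show ?case
      using v w by (intro bexI[of _ "v @ w"]) (auto simp: word_act_append append_words gens_words)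
  qed
qed

text \<open>The label of a closed path would act trivially, yet it makes the empty normal form longer.\<close>

theorem zigzag_not_closed:
  assumes z: "zigzag (\<lambda>_. carrier (amalgam_group D)) i t t'"
  shows "t \<noteq> t'"
proof
  assume eq: "t = t'"
  obtain w x s where w: "w \<in> words (all_gens D)" "t' = t \<otimes>\<^bsub>amalgam_group D\<^esub> element D w"
    "snd (word_act w (\<one>\<^bsub>amal D\<^esub>, [])) = (i, x) # s"
    using zigzag_word[OF _ z] by blast
  have "t \<in> carrier (amalgam_group D)" using zigzag_start[OF z] .
  then have "element D w = element D []"
    using w(1,2) eq element_closed[OF w(1)] by (metis element_Nil l_cancel_one' r_cancel_one)
  then have "word_eq (all_gens D) (all_rels D) w []" using w(1) element_eq_iff by blast
  then have "word_act w (\<one>\<^bsub>amal D\<^esub>, []) = word_act [] (\<one>\<^bsub>amal D\<^esub>, [])"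
    by (rule word_act_cong) (simp add: pair.forms_def)
  then show False using w(3) by (simp add: word_act_def)
qed

end

section \<open>Labelled graphs and their monochromatic components\<close>

lemma path_verts: "path \<Gamma> u p v \<Longrightarrow> u \<in> verts \<Gamma> \<and> v \<in> verts \<Gamma>"
  by (induction p arbitrary: u) auto

lemma path_append: "path \<Gamma> u (p @ q) w \<longleftrightarrow> (\<exists>v. path \<Gamma> u p v \<and> path \<Gamma> v q w)"
  by (induction p arbitrary: u) (auto dest: path_verts)

lemma path_edges: "path \<Gamma> u p v \<Longrightarrow> set p \<subseteq> edges \<Gamma>"
  by (induction p arbitrary: u) auto

lemma path_lab_append: "path_lab \<Gamma> (p @ q) = path_lab \<Gamma> p @ path_lab \<Gamma> q"
  by (simp add: path_lab_def)

lemma path_lab_simps [simp]: "path_lab \<Gamma> [] = []" "path_lab \<Gamma> (e # p) = lab \<Gamma> e # path_lab \<Gamma> p"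
  by (simp_all add: path_lab_def)

lemma labelled_graphD:
  assumes "labelled_graph X \<Gamma>" "e \<in> edges \<Gamma>"
  shows "ini \<Gamma> e \<in> verts \<Gamma>" "ter \<Gamma> e \<in> verts \<Gamma>" "bar \<Gamma> e \<in> edges \<Gamma>" "lab \<Gamma> e \<in> letters X"
    "lab \<Gamma> (bar \<Gamma> e) = inv_letter (lab \<Gamma> e)" "ini \<Gamma> (bar \<Gamma> e) = ter \<Gamma> e" "ter \<Gamma> (bar \<Gamma> e) = ini \<Gamma> e"
  using assms unfolding labelled_graph_def ter_def by simp_all

lemma path_edge: "labelled_graph X \<Gamma> \<Longrightarrow> e \<in> edges \<Gamma> \<Longrightarrow> path \<Gamma> (ini \<Gamma> e) [e] (ter \<Gamma> e)"
  by (simp add: labelled_graphD)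

lemma path_lab_words: "labelled_graph X \<Gamma> \<Longrightarrow> path \<Gamma> u p v \<Longrightarrow> path_lab \<Gamma> p \<in> words X"
  by (induction p arbitrary: u) (auto simp: Cons_words labelled_graphD)

lemma path_reverse:
  assumes "labelled_graph X \<Gamma>" "path \<Gamma> u p v"
  shows "\<exists>q. path \<Gamma> v q u \<and> path_lab \<Gamma> q = inv_word (path_lab \<Gamma> p)"
  using assms(2)
proof (induction p arbitrary: u)
  case Nil
  then show ?case by (intro exI[of _ "[]"]) (auto simp: inv_word_def)
next
  case (Cons e p)
  then obtain q where q: "path \<Gamma> v q (ter \<Gamma> e)" "path_lab \<Gamma> q = inv_word (path_lab \<Gamma> p)" by auto
  have "path \<Gamma> (ter \<Gamma> e) [bar \<Gamma> e] u"
    using path_edge[OF assms(1), of "bar \<Gamma> e"] Cons.prems labelled_graphD[OF assms(1)] by simp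
  then have "path \<Gamma> v (q @ [bar \<Gamma> e]) u" using q(1) path_append by metis
  moreover have "path_lab \<Gamma> (q @ [bar \<Gamma> e]) = inv_word (path_lab \<Gamma> (e # p))"
    using q(2) Cons.prems labelled_graphD[OF assms(1)] by (simp add: path_lab_append inv_word_def)
  ultimately show ?case by blast
qed

lemma subgraph_path: "subgraph C \<Gamma> \<Longrightarrow> path C u p v \<Longrightarrow> path \<Gamma> u p v"
  by (induction p arbitrary: u) (auto simp: subgraph_def ter_def)

lemma subgraph_path_lab: "subgraph C \<Gamma> \<Longrightarrow> path_lab C p = path_lab \<Gamma> p"
  by (simp add: subgraph_def path_lab_def)

definition reaches :: "('x, 'a) amalgam_data \<Rightarrow> ('v, 'e, 'x) lgraph \<Rightarrow> 'v \<Rightarrow> 'x word set \<Rightarrow> 'v \<Rightarrow> bool" where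
  "reaches D \<Gamma> v\<^sub>0 g v \<longleftrightarrow> (\<exists>p. path \<Gamma> v\<^sub>0 p v \<and> element D (path_lab \<Gamma> p) = g)"

definition coloured :: "('x, 'a) amalgam_data \<Rightarrow> ('v, 'e, 'x) lgraph \<Rightarrow> factor \<Rightarrow> 'v \<Rightarrow> bool" where
  "coloured D \<Gamma> i v \<longleftrightarrow> (\<exists>e\<in>edges \<Gamma>. ini \<Gamma> e = v \<and> lab \<Gamma> e \<in> letters (gens D i))"

text \<open>The cosets \<open>g G\<^sub>i\<close> contained in this set are the vertices of the Bass--Serre tree that
the graph occupies.\<close>

definition labels_to :: "('x, 'a) amalgam_data \<Rightarrow> ('v, 'e, 'x) lgraph \<Rightarrow> 'v \<Rightarrow> factor \<Rightarrow> 'x word set set" where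
  "labels_to D \<Gamma> v\<^sub>0 i = {g. \<exists>v. reaches D \<Gamma> v\<^sub>0 g v \<and> coloured D \<Gamma> i v}"

definition comp_of :: "('x, 'a) amalgam_data \<Rightarrow> ('v, 'e, 'x) lgraph \<Rightarrow> factor \<Rightarrow> 'v \<Rightarrow> ('v, 'e, 'x) lgraph" where
  "comp_of D \<Gamma> i v =
    (let W = {w. \<exists>p. path \<Gamma> v p w \<and> path_lab \<Gamma> p \<in> words (gens D i)}
     in \<lparr> verts = W, edges = {e \<in> edges \<Gamma>. ini \<Gamma> e \<in> W \<and> lab \<Gamma> e \<in> letters (gens D i)},
          ini = ini \<Gamma>, bar = bar \<Gamma>, lab = lab \<Gamma> \<rparr>)"

lemma comp_of_simps [simp]:
  "w \<in> verts (comp_of D \<Gamma> i v) \<longleftrightarrow> (\<exists>p. path \<Gamma> v p w \<and> path_lab \<Gamma> p \<in> words (gens D i))"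
  "e \<in> edges (comp_of D \<Gamma> i v) \<longleftrightarrow>
    e \<in> edges \<Gamma> \<and> ini \<Gamma> e \<in> verts (comp_of D \<Gamma> i v) \<and> lab \<Gamma> e \<in> letters (gens D i)"
  "ini (comp_of D \<Gamma> i v) = ini \<Gamma>" "bar (comp_of D \<Gamma> i v) = bar \<Gamma>" "lab (comp_of D \<Gamma> i v) = lab \<Gamma>"
  by (simp_all add: comp_of_def Let_def)

lemma bichromatic_iff: "bichromatic D \<Gamma> v \<longleftrightarrow> (\<forall>i. coloured D \<Gamma> i v)"
  by (simp add: bichromatic_def coloured_def)

context
  fixes D :: "('x, 'a) amalgam_data" and \<Gamma> :: "('v, 'e, 'x) lgraph"
  assumes lg: "labelled_graph (all_gens D) \<Gamma>"
begin

lemma comp_of_path: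
  assumes "u \<in> verts (comp_of D \<Gamma> i v)" "path \<Gamma> u p w" "path_lab \<Gamma> p \<in> words (gens D i)"
  shows "path (comp_of D \<Gamma> i v) u p w"
  using assms
proof (induction p arbitrary: u)
  case Nil
  then show ?case by simp
next
  case (Cons e p)
  from Cons.prems(1) obtain q where q: "path \<Gamma> v q u" "path_lab \<Gamma> q \<in> words (gens D i)" by auto
  have "path \<Gamma> u [e] (ter \<Gamma> e)" using Cons.prems(2) path_edge[OF lg, of e] by auto
  then have "path \<Gamma> v (q @ [e]) (ter \<Gamma> e)" using q(1) path_append by metis
  moreover have "path_lab \<Gamma> (q @ [e]) \<in> words (gens D i)"
    using q(2) Cons.prems(3) by (simp add: path_lab_append append_words_iff Cons_words)
  ultimately have "ter \<Gamma> e \<in> verts (comp_of D \<Gamma> i v)" by auto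
  then have "path (comp_of D \<Gamma> i v) (ter \<Gamma> e) p w"
    using Cons.IH Cons.prems by (simp add: Cons_words)
  then show ?case
    using Cons.prems by (simp add: Cons_words ter_def)
qed

lemma subgraph_comp_of: "subgraph (comp_of D \<Gamma> i v) \<Gamma>"
proof -
  have "bar \<Gamma> e \<in> edges (comp_of D \<Gamma> i v)" if e: "e \<in> edges (comp_of D \<Gamma> i v)" for e
  proof -
    have e': "e \<in> edges \<Gamma>" "lab \<Gamma> e \<in> letters (gens D i)" using e by auto
    then have "path (comp_of D \<Gamma> i v) (ini \<Gamma> e) [e] (ter \<Gamma> e)"
      using e by (intro comp_of_path path_edge[OF lg]) (auto simp: Cons_words)
    then have "ter \<Gamma> e \<in> verts (comp_of D \<Gamma> i v)" using path_verts by metis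
    then show ?thesis
      using e' labelled_graphD[OF lg e'(1)] by (simp add: inv_letter_letters)
  qed
  then show ?thesis
    unfolding subgraph_def by (auto dest: path_verts)
qed

lemma comp_of_path_words: "path (comp_of D \<Gamma> i v) u p w \<Longrightarrow> path_lab \<Gamma> p \<in> words (gens D i)"
  by (induction p arbitrary: u) (auto simp: Cons_words)

lemma mono_subgraph_comp_of:
  assumes "v \<in> verts \<Gamma>" "edges (comp_of D \<Gamma> i v) \<noteq> {}"
  shows "mono_subgraph D i \<Gamma> (comp_of D \<Gamma> i v)"
proof -
  let ?C = "comp_of D \<Gamma> i v"
  have v: "v \<in> verts ?C" using assms(1) by (auto intro!: exI[of _ "[]"])
  have "\<exists>p. path ?C a p b" if a: "a \<in> verts ?C" and b: "b \<in> verts ?C" for a b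
  proof -
    from a obtain p where p: "path \<Gamma> v p a" "path_lab \<Gamma> p \<in> words (gens D i)" by auto
    from b obtain q where q: "path \<Gamma> v q b" "path_lab \<Gamma> q \<in> words (gens D i)" by auto
    obtain p' where p': "path \<Gamma> a p' v" "path_lab \<Gamma> p' = inv_word (path_lab \<Gamma> p)"
      using path_reverse[OF lg p(1)] by blast
    have "path \<Gamma> a (p' @ q) b" using p'(1) q(1) path_append by metis
    moreover have "path_lab \<Gamma> (p' @ q) \<in> words (gens D i)"
      using p p' q by (simp add: path_lab_append append_words_iff inv_word_words)
    ultimately show ?thesis using comp_of_path[OF a] by blast
  qed
  then have "connected_graph ?C" using v unfolding connected_graph_def by blast
  then show ?thesis using assms(2) subgraph_comp_of unfolding mono_subgraph_def by simp
qed

text \<open>Maximality holds because a connected subgraph of the \<open>i\<close>-th colour through \<open>v\<close> only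
has vertices that can be reached from \<open>v\<close> by reading words in the letters of this colour.\<close>

lemma mono_component_comp_of:
  assumes v: "v \<in> verts \<Gamma>" and ne: "edges (comp_of D \<Gamma> i v) \<noteq> {}"
  shows "mono_component D i \<Gamma> (comp_of D \<Gamma> i v)"
proof -
  let ?C = "comp_of D \<Gamma> i v"
  have "C' = ?C" if C': "mono_subgraph D i \<Gamma> C'" and sub: "subgraph ?C C'" for C'
  proof -
    have s: "subgraph C' \<Gamma>" using C' by (simp add: mono_subgraph_def)
    have "v \<in> verts ?C" using v by (auto intro!: exI[of _ "[]"])
    then have v': "v \<in> verts C'" using sub unfolding subgraph_def by blast
    have V: "w \<in> verts ?C" if w: "w \<in> verts C'" for w
    proof -
      obtain p where p: "path C' v p w"
        using C' v' w unfolding mono_subgraph_def connected_graph_def by blast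
      have "path_lab C' p \<in> words (gens D i)"
        using path_edges[OF p] C' unfolding mono_subgraph_def path_lab_def words_def by fastforce
      then show ?thesis
        using subgraph_path[OF s p] subgraph_path_lab[OF s, of p] by auto
    qed
    have E: "e \<in> edges ?C" if e: "e \<in> edges C'" for e
    proof -
      have "ini \<Gamma> e \<in> verts C'" "e \<in> edges \<Gamma>" using s e by (auto simp: subgraph_def)
      moreover have "lab \<Gamma> e \<in> letters (gens D i)"
        using C' e s by (auto simp: mono_subgraph_def subgraph_def)
      ultimately show ?thesis using V by simp
    qed
    have "verts C' = verts ?C" "edges C' = edges ?C"
      using V E sub unfolding subgraph_def by blast+
    moreover have "ini C' = ini ?C" "bar C' = bar ?C" "lab C' = lab ?C"
      using sub unfolding subgraph_def by simp_all
    ultimately show ?thesis by simp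
  qed
  then show ?thesis
    using mono_subgraph_comp_of[OF v ne] unfolding mono_component_def by blast
qed

lemma edges_comp_of:
  assumes "coloured D \<Gamma> i v"
  shows "v \<in> verts \<Gamma>" "v \<in> verts (comp_of D \<Gamma> i v)" "edges (comp_of D \<Gamma> i v) \<noteq> {}"
proof -
  obtain e where e: "e \<in> edges \<Gamma>" "ini \<Gamma> e = v" "lab \<Gamma> e \<in> letters (gens D i)"
    using assms unfolding coloured_def by blast
  show v: "v \<in> verts \<Gamma>" using e labelled_graphD[OF lg] by auto
  then show v': "v \<in> verts (comp_of D \<Gamma> i v)" by (auto intro!: exI[of _ "[]"])
  then have "e \<in> edges (comp_of D \<Gamma> i v)" using e by simp
  then show "edges (comp_of D \<Gamma> i v) \<noteq> {}" by blast
qed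

lemma coloured_path_end:
  assumes "coloured D \<Gamma> i v" "path \<Gamma> v p u" "path_lab \<Gamma> p \<in> words (gens D i)"
  shows "coloured D \<Gamma> i u"
proof (cases p rule: rev_cases)
  case Nil
  then show ?thesis using assms by simp
next
  case (snoc q e)
  then have e: "e \<in> edges \<Gamma>" "ter \<Gamma> e = u" "lab \<Gamma> e \<in> letters (gens D i)"
    using assms by (auto simp: path_append path_lab_append append_words_iff Cons_words)
  show ?thesis
    unfolding coloured_def using labelled_graphD[OF lg e(1)] e inv_letter_letters by metis
qed

end

text \<open>In a Cayley graph of cosets an edge is the pair of its initial vertex and its label.\<close>

lemma cover_edge:
  assumes "cover D i C" "\<And>e. e \<in> edges C \<Longrightarrow> ini C e \<in> verts C"
    and v: "v \<in> verts C" and l: "l \<in> letters (gens D i)"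
  shows "\<exists>!e. e \<in> edges C \<and> ini C e = v \<and> lab C e = l"
proof -
  obtain S f g where iso: "graph_isomorphism f g C (cayley D i S)"
    using assms(1) unfolding cover_def isomorphic_def by blast
  have f: "inj_on f (verts C)" "f ` verts C = verts (cayley D i S)"
    and g: "inj_on g (edges C)" "g ` edges C = edges (cayley D i S)"
    using iso by (auto simp: graph_isomorphism_def bij_betw_def)
  have lab: "g e = (f (ini C e), lab C e)" if "e \<in> edges C" for e
  proof -
    have "fst (g e) = f (ini C e)" "snd (g e) = lab C e"
      using iso that by (auto simp: graph_isomorphism_def graph_morphism_def cayley_def)
    then show ?thesis by (metis prod.collapse)
  qed
  have "(f v, l) \<in> edges (cayley D i S)" using f(2) v l by (auto simp: cayley_def)
  then obtain e where e: "e \<in> edges C" "(f v, l) = g e" using g(2) by blast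
  show ?thesis
  proof (intro ex1I conjI)
    show "ini C e = v" using e lab assms(2) v f(1) by (metis Pair_inject inj_onD)
    show "lab C e = l" using e lab by (metis Pair_inject)
    show "e' = e" if "e' \<in> edges C \<and> ini C e' = v \<and> lab C e' = l" for e'
      using that e lab g(1) by (metis inj_onD)
  qed (rule e(1))
qed

section \<open>Precovers as invariant subtrees\<close>

locale precover_at = presented_amalgam D
  for D :: "('x, 'a) amalgam_data" +
  fixes \<Gamma> :: "('v, 'e, 'x) lgraph" and v\<^sub>0 :: 'v
  assumes precover: "precover D \<Gamma>" and base: "v\<^sub>0 \<in> verts \<Gamma>"
begin

abbreviation gmult (infixl "\<cdot>" 70) where
  "g \<cdot> h \<equiv> g \<otimes>\<^bsub>amalgam_group D\<^esub> h"

abbreviation ginv where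
  "ginv g \<equiv> inv\<^bsub>amalgam_group D\<^esub> g"

abbreviation at :: "'x word set \<Rightarrow> 'v \<Rightarrow> bool" where
  "at \<equiv> reaches D \<Gamma> v\<^sub>0"

abbreviation component :: "factor \<Rightarrow> 'v \<Rightarrow> ('v, 'e, 'x) lgraph" where
  "component \<equiv> comp_of D \<Gamma>"

abbreviation N :: "factor \<Rightarrow> 'x word set set" where
  "N \<equiv> labels_to D \<Gamma> v\<^sub>0"

lemma graph: "labelled_graph (all_gens D) \<Gamma>"
  using precover by (simp add: precover_def)

lemma path_words: "path \<Gamma> u p v \<Longrightarrow> path_lab \<Gamma> p \<in> words (all_gens D)"
  by (rule path_lab_words[OF graph])

lemma at_one: "at \<one>\<^bsub>amalgam_group D\<^esub> v\<^sub>0"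
  unfolding reaches_def using base by (intro exI[of _ "[]"]) (simp add: element_Nil)

lemma at_carrier: "at g v \<Longrightarrow> g \<in> carrier (amalgam_group D) \<and> v \<in> verts \<Gamma>"
  unfolding reaches_def using element_closed path_words path_verts by metis

lemma at_path: "at g v \<Longrightarrow> path \<Gamma> v q w \<Longrightarrow> at (g \<cdot> element D (path_lab \<Gamma> q)) w"
  unfolding reaches_def by (metis element_append path_append path_lab_append path_words)

text \<open>Going back along one path and forth along the other gives a path with trivial label, which is closed
in a \<open>G\<close>-based graph.\<close>

lemma same_end:
  assumes p: "path \<Gamma> u p v" and q: "path \<Gamma> u q w"
    and eq: "element D (path_lab \<Gamma> p) = element D (path_lab \<Gamma> q)"
  shows "v = w"
proof -
  obtain p' where p': "path \<Gamma> v p' u" "path_lab \<Gamma> p' = inv_word (path_lab \<Gamma> p)"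
    using path_reverse[OF graph p] by blast
  have w: "path_lab \<Gamma> p \<in> words (all_gens D)" "path_lab \<Gamma> q \<in> words (all_gens D)"
    using p q path_words by blast+
  have pq: "path \<Gamma> v (p' @ q) w" using p'(1) q path_append by metis
  have "element D (path_lab \<Gamma> (p' @ q)) = element D []"
    using p'(2) w eq element_closed[OF w(2)]
    by (simp add: path_lab_append element_append inv_word_words element_inv element_Nil)
  then have "word_eq (all_gens D) (all_rels D) (path_lab \<Gamma> (p' @ q)) []"
    using element_eq_iff path_words[OF pq] by blast
  then show ?thesis using pq precover unfolding precover_def G_based_def by blast
qed

lemma at_det: "at g v \<Longrightarrow> at g w \<Longrightarrow> v = w"
  unfolding reaches_def using same_end by metis

lemma at_surj: "v \<in> verts \<Gamma> \<Longrightarrow> \<exists>g. at g v"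
  using precover base unfolding reaches_def precover_def connected_graph_def by blast

lemma in_Lab_iff: "h \<in> Lab D \<Gamma> v\<^sub>0 \<longleftrightarrow> at h v\<^sub>0"
  unfolding Lab_def reaches_def by blast

lemma at_H: "h \<in> Lab D \<Gamma> v\<^sub>0 \<Longrightarrow> at g v \<Longrightarrow> at (h \<cdot> g) v"
  using at_path unfolding in_Lab_iff by (metis reaches_def)

lemma at_inv:
  assumes "at g v" "path \<Gamma> v q w"
  obtains q' where "path \<Gamma> w q' v" "element D (path_lab \<Gamma> q') = ginv (element D (path_lab \<Gamma> q))"
  using path_reverse[OF graph assms(2)] element_inv path_words[OF assms(2)] by metis

lemma at_quotient:
  assumes "at g v" "at g' v"
  shows "g' \<cdot> ginv g \<in> Lab D \<Gamma> v\<^sub>0"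
proof -
  obtain p where p: "path \<Gamma> v\<^sub>0 p v" "element D (path_lab \<Gamma> p) = g"
    using assms(1) unfolding reaches_def by blast
  obtain q where "path \<Gamma> v q v\<^sub>0" "element D (path_lab \<Gamma> q) = ginv g"
    using at_inv[OF at_one p(1)] p(2) by blast
  then show ?thesis using at_path[OF assms(2)] in_Lab_iff by metis
qed

sublocale tree_action "amalgam_group D" "factor_image D" "amal_image D" "Lab D \<Gamma> v\<^sub>0"
proof (intro tree_action.intro tree_action_axioms.intro)
  show "factor_subgroups (amalgam_group D) (factor_image D) (amal_image D)"
    by (rule factor_subgroups_axioms)
  show "t \<noteq> t'" if "zigzag (\<lambda>_. carrier (amalgam_group D)) i t t'" for i t t'
    using zigzag_not_closed[OF that] .
  show "subgroup (Lab D \<Gamma> v\<^sub>0) (amalgam_group D)"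
  proof (rule subgroupI)
    show "Lab D \<Gamma> v\<^sub>0 \<subseteq> carrier (amalgam_group D)" using in_Lab_iff at_carrier by blast
    show "Lab D \<Gamma> v\<^sub>0 \<noteq> {}" using in_Lab_iff at_one by blast
    show "ginv h \<in> Lab D \<Gamma> v\<^sub>0" if "h \<in> Lab D \<Gamma> v\<^sub>0" for h
      using at_quotient[OF _ at_one, of h] that at_carrier unfolding in_Lab_iff by simp
    show "h \<cdot> k \<in> Lab D \<Gamma> v\<^sub>0" if "h \<in> Lab D \<Gamma> v\<^sub>0" "k \<in> Lab D \<Gamma> v\<^sub>0" for h k
      using at_H that unfolding in_Lab_iff by blast
  qed
qed

lemma component_mono: "coloured D \<Gamma> i v \<Longrightarrow> mono_component D i \<Gamma> (component i v)"
  by (intro mono_component_comp_of[OF graph] edges_comp_of[OF graph])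

lemma mono_component_edge:
  assumes C: "mono_component D i \<Gamma> C" and v: "v \<in> verts C" and l: "l \<in> letters (gens D i)"
  shows "\<exists>!e. e \<in> edges C \<and> ini \<Gamma> e = v \<and> lab \<Gamma> e = l"
proof -
  have s: "subgraph C \<Gamma>" using C by (simp add: mono_component_def mono_subgraph_def)
  have "cover D i C" using precover C by (simp add: precover_def)
  then show ?thesis using cover_edge[of D i C v l] s v l by (auto simp: subgraph_def)
qed

lemma edge_exists:
  assumes "coloured D \<Gamma> i v" "l \<in> letters (gens D i)"
  shows "\<exists>e\<in>edges \<Gamma>. ini \<Gamma> e = v \<and> lab \<Gamma> e = l"
  using mono_component_edge[OF component_mono[OF assms(1)] edges_comp_of(2)[OF graph assms(1)] assms(2)]
  by auto

lemma edge_unique: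
  assumes "e \<in> edges \<Gamma>" "e' \<in> edges \<Gamma>" "ini \<Gamma> e = ini \<Gamma> e'" "lab \<Gamma> e = lab \<Gamma> e'"
  shows "e = e'"
proof -
  obtain i where i: "lab \<Gamma> e \<in> letters (gens D i)"
    using labelled_graphD(4)[OF graph assms(1)] by (auto simp: letters_all)
  then have c: "coloured D \<Gamma> i (ini \<Gamma> e)" using assms(1) unfolding coloured_def by blast
  show ?thesis
    using mono_component_edge[OF component_mono[OF c] edges_comp_of(2)[OF graph c] i]
      edges_comp_of(2)[OF graph c] assms i by (metis comp_of_simps(2))
qed

lemma read_word:
  assumes "coloured D \<Gamma> i v" "w \<in> words (gens D i)"
  shows "\<exists>p u. path \<Gamma> v p u \<and> path_lab \<Gamma> p = w"
  using assms
proof (induction w arbitrary: v)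
  case Nil
  then show ?case using edges_comp_of(1)[OF graph] by (intro exI[of _ "[]"]) auto
next
  case (Cons l w)
  then obtain e where e: "e \<in> edges \<Gamma>" "ini \<Gamma> e = v" "lab \<Gamma> e = l"
    using edge_exists[of i v l] by (auto simp: Cons_words)
  have c: "coloured D \<Gamma> i (ter \<Gamma> e)"
    using coloured_path_end[OF graph Cons.prems(1), of "[e]" "ter \<Gamma> e"] path_edge[OF graph e(1)] e Cons.prems
    by (auto simp: Cons_words)
  then obtain p u where "path \<Gamma> (ter \<Gamma> e) p u" "path_lab \<Gamma> p = w"
    using Cons.IH[OF c] Cons.prems(2) unfolding Cons_words by blast
  then show ?case
    using e labelled_graphD(1)[OF graph e(1)] by (intro exI[of _ "e # p"] exI[of _ u]) auto
qed

lemma at_factor: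
  assumes "at g v" "coloured D \<Gamma> i v" "x \<in> factor_image D i"
  shows "\<exists>p w. path \<Gamma> v p w \<and> path_lab \<Gamma> p \<in> words (gens D i) \<and> element D (path_lab \<Gamma> p) = x \<and>
    at (g \<cdot> x) w \<and> coloured D \<Gamma> i w"
proof -
  obtain u where u: "u \<in> words (gens D i)" "x = element D u"
    using assms(3) by (auto simp: factor_image_def)
  obtain p w where p: "path \<Gamma> v p w" "path_lab \<Gamma> p = u" using read_word[OF assms(2) u(1)] by blast
  then show ?thesis
    using u at_path[OF assms(1) p(1)] coloured_path_end[OF graph assms(2) p(1)] by blast
qed

lemma at_component:
  assumes "at g v" "w \<in> verts (component i v)"
  shows "\<exists>x\<in>factor_image D i. at (g \<cdot> x) w"
proof -
  obtain p where "path \<Gamma> v p w" "path_lab \<Gamma> p \<in> words (gens D i)" using assms(2) by auto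
  then show ?thesis using at_path[OF assms(1)] unfolding factor_image_def by blast
qed

lemma in_N_iff: "at g v \<Longrightarrow> g \<in> N i \<longleftrightarrow> coloured D \<Gamma> i v"
  unfolding labels_to_def using at_det by blast

lemma NE:
  assumes "g \<in> N i"
  obtains v where "at g v" "coloured D \<Gamma> i v"
  using assms unfolding labels_to_def by blast

text \<open>A path in the graph is a sequence of steps in the tree, one for each edge.\<close>

lemma at_steps:
  assumes "at g v"
  shows "(step N)\<^sup>*\<^sup>* \<one>\<^bsub>amalgam_group D\<^esub> g"
proof -
  have "(step N)\<^sup>*\<^sup>* \<one>\<^bsub>amalgam_group D\<^esub> (element D (path_lab \<Gamma> p))" if "path \<Gamma> v\<^sub>0 p v" for p v
    using that
  proof (induction p arbitrary: v rule: rev_induct)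
    case Nil
    then show ?case by (simp add: element_Nil)
  next
    case (snoc e p)
    then have p: "path \<Gamma> v\<^sub>0 p (ini \<Gamma> e)" and e: "e \<in> edges \<Gamma>" by (auto simp: path_append)
    obtain i where i: "lab \<Gamma> e \<in> letters (gens D i)"
      using labelled_graphD(4)[OF graph e] by (auto simp: letters_all)
    have l: "[lab \<Gamma> e] \<in> words (gens D i)" using i by (simp add: Cons_words)
    have "element D (path_lab \<Gamma> (p @ [e])) = element D (path_lab \<Gamma> p) \<cdot> element D [lab \<Gamma> e]"
      using element_append[OF path_words[OF p] gens_words[OF l]] by (simp add: path_lab_append)
    moreover have "element D (path_lab \<Gamma> p) \<in> N i"
      unfolding labels_to_def reaches_def coloured_def using p e i by blast
    ultimately have "step N (element D (path_lab \<Gamma> p)) (element D (path_lab \<Gamma> (p @ [e])))"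
      unfolding step_def factor_image_def using l by blast
    then show ?case using snoc.IH[OF p] by (rule rtranclp.rtrancl_into_rtrancl[rotated])
  qed
  then show ?thesis using assms unfolding reaches_def by blast
qed

lemma subtree_N: "subtree N"
proof -
  have "coset_closed N"
    unfolding coset_closed_def
  proof (intro allI conjI ballI)
    show "N i \<subseteq> carrier (amalgam_group D)" for i using at_carrier NE by blast
    show "g \<cdot> x \<in> N i" if "g \<in> N i" "x \<in> factor_image D i" for i g x
      using at_factor that in_N_iff by (metis NE)
  qed
  moreover have "h \<cdot> g \<in> N i" if "h \<in> Lab D \<Gamma> v\<^sub>0" "g \<in> N i" for i h g
    using that at_H in_N_iff by (metis NE)
  moreover have "(step N)\<^sup>*\<^sup>* \<one>\<^bsub>amalgam_group D\<^esub> g" if "g \<in> span N" for g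
  proof -
    have "\<exists>v. at g v" using that in_Lab_iff NE unfolding span_def by blast
    then show ?thesis using at_steps by blast
  qed
  ultimately show ?thesis unfolding subtree_def by blast
qed

text \<open>A vertex without any edge can only be the base point, which is reached exactly by the elements of
\<open>H\<close>; so the sets \<open>N i\<close> and \<open>H\<close> account for all vertices.\<close>

lemma in_span_iff: "g \<in> span N \<longleftrightarrow> (\<exists>v. at g v)"
proof
  assume "g \<in> span N"
  then show "\<exists>v. at g v" using in_Lab_iff NE unfolding span_def by blast
next
  assume "\<exists>v. at g v"
  then obtain v p where p: "path \<Gamma> v\<^sub>0 p v" "g = element D (path_lab \<Gamma> p)" and g: "at g v"
    unfolding reaches_def by blast
  show "g \<in> span N"
  proof (cases p rule: rev_cases)
    case Nil
    then show ?thesis using g p(1) in_Lab_iff unfolding span_def by auto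
  next
    case (snoc q e)
    then have e: "e \<in> edges \<Gamma>" "ter \<Gamma> e = v" using p(1) by (auto simp: path_append)
    then obtain i where "lab \<Gamma> e \<in> letters (gens D i)"
      using labelled_graphD(4)[OF graph e(1)] by (auto simp: letters_all)
    then have "coloured D \<Gamma> i v"
      unfolding coloured_def using labelled_graphD[OF graph e(1)] e(2) inv_letter_letters by metis
    then show ?thesis using in_N_iff[OF g] unfolding span_def by blast
  qed
qed

text \<open>Monochromatic components are the same as orbits of vertices of the tree.\<close>

lemma orbit_component:
  assumes g: "at g v" and c: "coloured D \<Gamma> i v"
  shows "orbit i g = {g'. \<exists>w\<in>verts (component i v). at g' w}"
proof (intro subset_antisym subsetI)
  fix g' assume "g' \<in> orbit i g"
  then obtain h x where hx: "h \<in> Lab D \<Gamma> v\<^sub>0" "x \<in> factor_image D i" "g' = h \<cdot> g \<cdot> x"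
    unfolding orbit_def by blast
  obtain p w where w: "path \<Gamma> v p w" "path_lab \<Gamma> p \<in> words (gens D i)" "at (g \<cdot> x) w"
    using at_factor[OF g c hx(2)] by blast
  have "g' = h \<cdot> (g \<cdot> x)" using hx g at_carrier H_carrier F_carrier by (simp add: m_assoc)
  then have "at g' w" using at_H[OF hx(1) w(3)] by simp
  moreover have "w \<in> verts (component i v)" using w(1,2) by auto
  ultimately show "g' \<in> {g'. \<exists>w\<in>verts (component i v). at g' w}" by blast
next
  fix g' assume "g' \<in> {g'. \<exists>w\<in>verts (component i v). at g' w}"
  then obtain w where w: "w \<in> verts (component i v)" "at g' w" by blast
  obtain x where x: "x \<in> factor_image D i" "at (g \<cdot> x) w" using at_component[OF g w(1)] by blast
  have h: "g' \<cdot> ginv (g \<cdot> x) \<in> Lab D \<Gamma> v\<^sub>0" using at_quotient[OF x(2) w(2)] .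
  have "g' = g' \<cdot> ginv (g \<cdot> x) \<cdot> g \<cdot> x"
    using at_carrier[OF w(2)] at_carrier[OF x(2)] at_carrier[OF g] F_carrier[OF x(1)]
    by (simp add: m_assoc del: inv_mult_group)
  then show "g' \<in> orbit i g" unfolding orbit_def using h x(1) by blast
qed

lemma finitely_many_orbits_N:
  assumes "finitely_many_components D \<Gamma>"
  shows "finitely_many_orbits N"
proof -
  have "orbit i ` N i \<subseteq> (\<lambda>C. {g. \<exists>w\<in>verts C. at g w}) ` mono_components D \<Gamma>" for i
  proof
    fix O' assume "O' \<in> orbit i ` N i"
    then obtain g v where g: "at g v" "coloured D \<Gamma> i v" "O' = orbit i g" using NE by blast
    have "component i v \<in> mono_components D \<Gamma>"
      using component_mono[OF g(2)] unfolding mono_components_def by blast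
    then show "O' \<in> (\<lambda>C. {g. \<exists>w\<in>verts C. at g w}) ` mono_components D \<Gamma>"
      using orbit_component[OF g(1,2)] g(3) by blast
  qed
  then show ?thesis
    using assms unfolding finitely_many_orbits_def finitely_many_components_def by (meson finite_surj)
qed

text \<open>The group of a component at \<open>\<theta>\<close> is the stabiliser of the corresponding vertex of the tree,
conjugated by \<open>t\<close>; the condition \<open>h \<cdot> t = t \<cdot> k\<close> expresses \<open>k\<close> as a conjugate of
an element of \<open>H\<close>.\<close>

lemma Lab_component:
  assumes t: "at t \<theta>" and c: "coloured D \<Gamma> i \<theta>"
  shows "Lab D (component i \<theta>) \<theta> = {k \<in> factor_image D i. \<exists>h\<in>Lab D \<Gamma> v\<^sub>0. h \<cdot> t = t \<cdot> k}"
proof (intro subset_antisym subsetI)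
  let ?C = "component i \<theta>"
  note sub = subgraph_comp_of[OF graph, of i \<theta>]
  have tc: "t \<in> carrier (amalgam_group D)" using at_carrier[OF t] by blast
  fix k assume "k \<in> Lab D ?C \<theta>"
  then obtain p where p: "path ?C \<theta> p \<theta>" "k = element D (path_lab \<Gamma> p)"
    unfolding Lab_def using subgraph_path_lab[OF sub] by auto
  then have k: "k \<in> factor_image D i"
    using comp_of_path_words[OF graph p(1)] unfolding factor_image_def by blast
  have "at (t \<cdot> k) \<theta>" using at_path[OF t subgraph_path[OF sub p(1)]] p(2) by simp
  then have "t \<cdot> k \<cdot> ginv t \<in> Lab D \<Gamma> v\<^sub>0" using at_quotient[OF t] by blast
  moreover have "t \<cdot> k \<cdot> ginv t \<cdot> t = t \<cdot> k" using tc F_carrier[OF k] by (simp add: m_assoc)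
  ultimately show "k \<in> {k \<in> factor_image D i. \<exists>h\<in>Lab D \<Gamma> v\<^sub>0. h \<cdot> t = t \<cdot> k}" using k by blast
next
  note sub = subgraph_comp_of[OF graph, of i \<theta>]
  fix k assume "k \<in> {k \<in> factor_image D i. \<exists>h\<in>Lab D \<Gamma> v\<^sub>0. h \<cdot> t = t \<cdot> k}"
  then obtain h where k: "k \<in> factor_image D i" "h \<in> Lab D \<Gamma> v\<^sub>0" "h \<cdot> t = t \<cdot> k" by blast
  obtain p w where p: "path \<Gamma> \<theta> p w" "path_lab \<Gamma> p \<in> words (gens D i)"
    "element D (path_lab \<Gamma> p) = k" "at (t \<cdot> k) w"
    using at_factor[OF t c k(1)] by blast
  have "w = \<theta>" using at_det p(4) at_H[OF k(2) t] k(3) by metis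
  then have "path (component i \<theta>) \<theta> p \<theta>"
    using comp_of_path[OF graph edges_comp_of(2)[OF graph c]] p by blast
  moreover have "k = element D (path_lab (component i \<theta>) p)"
    using p(3) subgraph_path_lab[OF sub, of p] by simp
  ultimately show "k \<in> Lab D (component i \<theta>) \<theta>" unfolding Lab_def by blast
qed

text \<open>If only one colour occurs, connectedness leaves room for a single component.\<close>

lemma whole_component:
  assumes none: "N (other i) = {}" and some: "N i \<noteq> {}"
  shows "component i v\<^sub>0 = \<Gamma>" "mono_component D i \<Gamma> (component i v\<^sub>0)"
proof -
  have lab: "lab \<Gamma> e \<in> letters (gens D i)" if e: "e \<in> edges \<Gamma>" for e
  proof -
    obtain k where k: "lab \<Gamma> e \<in> letters (gens D k)"
      using labelled_graphD(4)[OF graph e] by (auto simp: letters_all)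
    then have "coloured D \<Gamma> k (ini \<Gamma> e)" using e unfolding coloured_def by blast
    moreover obtain g where "at g (ini \<Gamma> e)"
      using at_surj labelled_graphD(1)[OF graph e] by blast
    ultimately have "N k \<noteq> {}" using in_N_iff by blast
    then have "k = i" using none neq_iff_other by metis
    then show ?thesis using k by simp
  qed
  have pw: "path_lab \<Gamma> p \<in> words (gens D i)" if "path \<Gamma> u p v" for u p v
    using path_edges[OF that] lab unfolding path_lab_def words_def by fastforce
  have V: "verts (component i v\<^sub>0) = verts \<Gamma>"
  proof (intro subset_antisym subsetI)
    show "v \<in> verts \<Gamma>" if "v \<in> verts (component i v\<^sub>0)" for v
      using that by (auto dest: path_verts)
    show "v \<in> verts (component i v\<^sub>0)" if "v \<in> verts \<Gamma>" for v
      using at_surj[OF that] pw unfolding reaches_def by auto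
  qed
  then have E: "edges (component i v\<^sub>0) = edges \<Gamma>"
    using lab labelled_graphD(1)[OF graph] comp_of_simps(2)[of _ D \<Gamma> i v\<^sub>0] by blast
  show "component i v\<^sub>0 = \<Gamma>"
    using V E comp_of_simps(3-5)[of D \<Gamma> i v\<^sub>0] by simp
  obtain v where "coloured D \<Gamma> i v" using some NE by blast
  then have "edges \<Gamma> \<noteq> {}" unfolding coloured_def by blast
  then show "mono_component D i \<Gamma> (component i v\<^sub>0)"
    using mono_component_comp_of[OF graph base] E by simp
qed

text \<open>The hypothesis \<open>leaf\<close> says that the tree vertex of the component is a leaf.  An element of the
group of the component leads from the attaching edge to an edge of the subtree at the same vertex, hence
lies in \<open>A\<close>; for the same reason the bichromatic vertices form a single \<open>A\<close>-orbit.\<close>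

lemma leaf_redundant:
  assumes t: "at t \<theta>" and c: "coloured D \<Gamma> i \<theta>" "coloured D \<Gamma> (other i) \<theta>"
    and leaf: "\<And>y. y \<in> factor_image D i \<Longrightarrow> t \<cdot> y \<in> N (other i) \<Longrightarrow> y \<in> amal_image D"
    and base': "v\<^sub>0 \<notin> verts (component i \<theta>) \<or>
      coloured D \<Gamma> (other i) v\<^sub>0 \<and> Lab D (component i \<theta>) \<theta> = {\<one>\<^bsub>amalgam_group D\<^esub>}"
  shows "redundant D \<Gamma> v\<^sub>0 i (component i \<theta>)"
proof -
  let ?C = "component i \<theta>" and ?C' = "component (other i) \<theta>"
  have vC: "\<theta> \<in> verts ?C" using edges_comp_of(2)[OF graph c(1)] .
  have C: "mono_component D i \<Gamma> ?C" using component_mono[OF c(1)] .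
  have "?C' \<in> mono_components D \<Gamma>"
    using component_mono[OF c(2)] unfolding mono_components_def by blast
  moreover have "?C' \<noteq> ?C"
  proof
    assume eq: "?C' = ?C"
    obtain e where "e \<in> edges ?C'" using edges_comp_of(3)[OF graph c(2)] by blast
    then have "lab \<Gamma> e \<in> letters (gens D (other i))" "lab \<Gamma> e \<in> letters (gens D i)"
      using eq comp_of_simps(2) by metis+
    then show False using letters_disjoint by (metis other_neq(1))
  qed
  ultimately have other_comp: "\<exists>C'\<in>mono_components D \<Gamma>. C' \<noteq> ?C" by blast
  have col: "coloured D \<Gamma> i w" if "w \<in> verts ?C" for w
    using that coloured_path_end[OF graph c(1)] by auto
  have bi: "bichromatic D \<Gamma> w \<longleftrightarrow> coloured D \<Gamma> (other i) w" if "w \<in> verts ?C" for w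
    using col[OF that] by (simp add: bichromatic_iff all_factor[of _ i])
  have "\<theta> \<in> VB D \<Gamma> ?C" using vC bi c(2) unfolding VB_def by blast
  moreover have "Lab D ?C \<theta> \<subseteq> amal_image D"
  proof
    fix k assume "k \<in> Lab D ?C \<theta>"
    then obtain h where k: "k \<in> factor_image D i" "h \<in> Lab D \<Gamma> v\<^sub>0" "h \<cdot> t = t \<cdot> k"
      unfolding Lab_component[OF t c(1)] by blast
    have "t \<cdot> k \<in> N (other i)" using at_H[OF k(2) t] k(3) in_N_iff c(2) by metis
    then show "k \<in> amal_image D" using leaf k(1) by blast
  qed
  moreover have "VB D \<Gamma> ?C = amal_orbit D i ?C \<theta>"
  proof (intro subset_antisym subsetI)
    fix w assume "w \<in> VB D \<Gamma> ?C"
    then have w: "w \<in> verts ?C" "coloured D \<Gamma> (other i) w" using bi unfolding VB_def by blast+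
    obtain y where y: "y \<in> factor_image D i" "at (t \<cdot> y) w" using at_component[OF t w(1)] by blast
    then have "y \<in> amal_image D" using leaf in_N_iff w(2) by blast
    then obtain u a where u: "represents D i u a" "y = element D u" by (rule amal_imageE)
    obtain p w' where p: "path \<Gamma> \<theta> p w'" "path_lab \<Gamma> p = u"
      using read_word[OF c(1) represents_words[OF u(1)]] by blast
    have "w' = w" using at_path[OF t p(1)] p(2) u(2) y(2) at_det by blast
    moreover have "path ?C \<theta> p w'"
      using comp_of_path[OF graph vC p(1)] p(2) represents_words[OF u(1)] by blast
    moreover have "represents D i (path_lab ?C p) a"
      using u(1) p(2) subgraph_path_lab[OF subgraph_comp_of[OF graph], of i \<theta> p] by simp
    ultimately show "w \<in> amal_orbit D i ?C \<theta>" unfolding amal_orbit_def by blast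
  next
    fix w assume "w \<in> amal_orbit D i ?C \<theta>"
    then obtain a p where p: "represents D i (path_lab ?C p) a" "path ?C \<theta> p w"
      unfolding amal_orbit_def by blast
    note sub = subgraph_comp_of[OF graph, of i \<theta>]
    let ?y = "element D (path_lab \<Gamma> p)"
    have "?y \<in> amal_image D" using amal_imageI[OF p(1)] subgraph_path_lab[OF sub, of p] by simp
    moreover have at: "at (t \<cdot> ?y) w" using at_path[OF t subgraph_path[OF sub p(2)]] .
    moreover have "t \<in> N (other i)" using in_N_iff[OF t] c(2) by blast
    ultimately have "t \<cdot> ?y \<in> N (other i)" using subtreeD(3)[OF subtree_N] A_F by blast
    then have "coloured D \<Gamma> (other i) w" using in_N_iff[OF at] by blast
    then show "w \<in> VB D \<Gamma> ?C" using path_verts[OF p(2)] bi unfolding VB_def by blast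
  qed
  moreover have "v\<^sub>0 \<notin> verts ?C \<or> v\<^sub>0 \<in> VB D \<Gamma> ?C \<and> Lab D ?C \<theta> = {\<one>\<^bsub>amalgam_group D\<^esub>}"
    using base' bi unfolding VB_def by blast
  ultimately show ?thesis unfolding redundant_def using C other_comp by blast
qed

lemma tight_N:
  assumes red: "reduced_precover D \<Gamma> v\<^sub>0"
  shows "tight N"
proof -
  have nored: "\<not> redundant D \<Gamma> v\<^sub>0 i C" for i C using red by (simp add: reduced_precover_def)
  have "Lab D \<Gamma> v\<^sub>0 \<noteq> {\<one>\<^bsub>amalgam_group D\<^esub>}" if "N i \<noteq> {}" "N (other i) = {}" for i
    using nored[of i \<Gamma>] whole_component[OF that(2,1)] unfolding redundant_def by auto
  moreover have "\<one>\<^bsub>amalgam_group D\<^esub> \<in> orbit i t \<and> \<not> (\<one>\<^bsub>amalgam_group D\<^esub> \<in> N (other i) \<and>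
      (\<forall>h\<in>Lab D \<Gamma> v\<^sub>0. \<forall>y\<in>factor_image D i. h \<cdot> t = t \<cdot> y \<longrightarrow> h = \<one>\<^bsub>amalgam_group D\<^esub>))"
    if t: "t \<in> N i" "t \<in> N (other i)"
      and leaf: "\<forall>y\<in>factor_image D i. t \<cdot> y \<in> N (other i) \<longrightarrow> y \<in> amal_image D" for i t
  proof -
    obtain \<theta> where \<theta>: "at t \<theta>" "coloured D \<Gamma> i \<theta>" using t(1) NE by blast
    have c: "coloured D \<Gamma> (other i) \<theta>" using t(2) in_N_iff[OF \<theta>(1)] by blast
    have tc: "t \<in> carrier (amalgam_group D)" using at_carrier[OF \<theta>(1)] by blast
    note L = leaf_redundant[OF \<theta> c leaf[rule_format]]
    have v0: "v\<^sub>0 \<in> verts (component i \<theta>)" using L nored by blast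
    then have "\<one>\<^bsub>amalgam_group D\<^esub> \<in> orbit i t" using orbit_component[OF \<theta>] at_one by blast
    moreover have False if one: "\<one>\<^bsub>amalgam_group D\<^esub> \<in> N (other i)"
      and triv: "\<forall>h\<in>Lab D \<Gamma> v\<^sub>0. \<forall>y\<in>factor_image D i. h \<cdot> t = t \<cdot> y \<longrightarrow> h = \<one>\<^bsub>amalgam_group D\<^esub>"
    proof -
      have "k = \<one>\<^bsub>amalgam_group D\<^esub>" if "k \<in> Lab D (component i \<theta>) \<theta>" for k
      proof -
        from that obtain h where k: "k \<in> factor_image D i" "h \<in> Lab D \<Gamma> v\<^sub>0" "h \<cdot> t = t \<cdot> k"
          unfolding Lab_component[OF \<theta>] by blast
        then have "h = \<one>\<^bsub>amalgam_group D\<^esub>" using triv by blast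
        then have "t \<cdot> k = t" using k(3) tc by simp
        then show ?thesis using tc F_carrier[OF k(1)] by simp
      qed
      moreover have "\<one>\<^bsub>amalgam_group D\<^esub> \<in> Lab D (component i \<theta>) \<theta>"
        unfolding Lab_component[OF \<theta>] using F_one tc by (auto intro!: bexI[OF _ H_one])
      moreover have "coloured D \<Gamma> (other i) v\<^sub>0" using one in_N_iff[OF at_one] by blast
      ultimately show False using L nored by blast
    qed
    ultimately show ?thesis by blast
  qed
  moreover have "\<one>\<^bsub>amalgam_group D\<^esub> \<in> N (other i)"
    if one: "\<one>\<^bsub>amalgam_group D\<^esub> \<in> N i" and ne: "Lab D \<Gamma> v\<^sub>0 \<inter> amal_image D \<noteq> {\<one>\<^bsub>amalgam_group D\<^esub>}" for i
  proof -
    have c: "coloured D \<Gamma> i v\<^sub>0" using one in_N_iff[OF at_one] by blast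
    obtain h where h: "h \<in> Lab D \<Gamma> v\<^sub>0" "h \<in> amal_image D" "h \<noteq> \<one>\<^bsub>amalgam_group D\<^esub>"
      using ne H_one A_one by blast
    then have "h \<in> Lab D (component i v\<^sub>0) v\<^sub>0"
      unfolding Lab_component[OF at_one c]
      using A_F[OF h(2)] A_carrier[OF h(2)] by (auto intro!: bexI[OF _ h(1)])
    then have "Lab D (component i v\<^sub>0) v\<^sub>0 \<inter> amal_image D \<noteq> {\<one>\<^bsub>amalgam_group D\<^esub>}" using h by blast
    then obtain j C where C: "j \<noteq> i" "mono_component D j \<Gamma> C" "v\<^sub>0 \<in> verts C"
      using red component_mono[OF c] edges_comp_of(2)[OF graph c] unfolding reduced_precover_def by blast
    then obtain e where e: "e \<in> edges C" "lab \<Gamma> e \<in> letters (gens D j)"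
      by (auto simp: mono_component_def mono_subgraph_def subgraph_def)
    have "edges C \<subseteq> edges \<Gamma>" using C(2) by (auto simp: mono_component_def mono_subgraph_def subgraph_def)
    then have "coloured D \<Gamma> j v\<^sub>0"
      using mono_component_edge[OF C(2,3) e(2)] e(2) unfolding coloured_def by fastforce
    then show ?thesis using C(1) in_N_iff[OF at_one] neq_iff_other by metis
  qed
  ultimately show ?thesis unfolding tight_def by blast
qed

end

section \<open>Isomorphism of precovers with the same vertices\<close>

lemma rel_bij_betw:
  assumes "\<And>x. x \<in> X \<Longrightarrow> \<exists>y\<in>Y. R x y" "\<And>y. y \<in> Y \<Longrightarrow> \<exists>x\<in>X. R x y"
    and "\<And>x y y'. R x y \<Longrightarrow> R x y' \<Longrightarrow> y = y'" "\<And>x x' y. R x y \<Longrightarrow> R x' y \<Longrightarrow> x = x'"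
  obtains f where "bij_betw f X Y" "\<And>x. x \<in> X \<Longrightarrow> R x (f x)"
proof -
  obtain f where f: "\<And>x. x \<in> X \<Longrightarrow> f x \<in> Y \<and> R x (f x)" using assms(1) by metis
  have "inj_on f X" using f assms(4) by (metis inj_onI)
  moreover have "Y \<subseteq> f ` X"
  proof
    fix y assume "y \<in> Y"
    then obtain x where "x \<in> X" "R x y" using assms(2) by blast
    then show "y \<in> f ` X" using f assms(3) by blast
  qed
  ultimately have "bij_betw f X Y" using f unfolding bij_betw_def by blast
  then show thesis using that f by blast
qed

text \<open>Vertices of the two graphs correspond if they are reached by paths representing the same element.
As all hypotheses are symmetric in the two graphs, only one half of each bijection has to be constructed.\<close>

locale precover_pair = P: precover_at D \<Gamma> v\<^sub>0 + Q: precover_at D \<Delta> w\<^sub>0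
  for D :: "('x, 'a) amalgam_data"
    and \<Gamma> :: "('v, 'e, 'x) lgraph" and v\<^sub>0 :: 'v and \<Delta> :: "('w, 'f, 'x) lgraph" and w\<^sub>0 :: 'w +
  assumes Lab_eq: "Lab D \<Gamma> v\<^sub>0 = Lab D \<Delta> w\<^sub>0"
    and labels_eq: "labels_to D \<Gamma> v\<^sub>0 = labels_to D \<Delta> w\<^sub>0"
begin

definition corr :: "'v \<Rightarrow> 'w \<Rightarrow> bool" where
  "corr v w \<longleftrightarrow> (\<exists>g. P.at g v \<and> Q.at g w)"

lemma corr_at: "corr v w \<Longrightarrow> P.at g v \<Longrightarrow> Q.at g w"
proof -
  assume "corr v w" and g: "P.at g v"
  then obtain g' where g': "P.at g' v" "Q.at g' w" unfolding corr_def by blast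
  have "Q.at (g \<otimes>\<^bsub>amalgam_group D\<^esub> inv\<^bsub>amalgam_group D\<^esub> g' \<otimes>\<^bsub>amalgam_group D\<^esub> g') w"
    using Q.at_H[OF _ g'(2)] P.at_quotient[OF g'(1) g] Lab_eq by blast
  then show ?thesis using P.at_carrier[OF g] P.at_carrier[OF g'(1)] by (simp add: P.m_assoc)
qed

lemma corr_total:
  assumes "v \<in> verts \<Gamma>"
  shows "\<exists>w\<in>verts \<Delta>. corr v w"
proof -
  obtain g where g: "P.at g v" using P.at_surj[OF assms] by blast
  then have "g \<in> P.span (labels_to D \<Gamma> v\<^sub>0)" using P.in_span_iff by blast
  then have "g \<in> Q.span (labels_to D \<Delta> w\<^sub>0)"
    unfolding P.span_def Q.span_def using Lab_eq labels_eq by simp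
  then show ?thesis using g Q.in_span_iff Q.at_carrier unfolding corr_def by blast
qed

lemma corr_functional: "corr v w \<Longrightarrow> corr v w' \<Longrightarrow> w = w'"
  using corr_at Q.at_det unfolding corr_def by blast

lemma corr_coloured: "corr v w \<Longrightarrow> coloured D \<Gamma> i v \<Longrightarrow> coloured D \<Delta> i w"
  using P.in_N_iff Q.in_N_iff labels_eq unfolding corr_def by metis

lemma corr_edge:
  assumes "e \<in> edges \<Gamma>"
  shows "\<exists>e'\<in>edges \<Delta>. corr (ini \<Gamma> e) (ini \<Delta> e') \<and> lab \<Delta> e' = lab \<Gamma> e"
proof -
  obtain i where i: "lab \<Gamma> e \<in> letters (gens D i)"
    using labelled_graphD(4)[OF P.graph assms] by (auto simp: P.letters_all)
  obtain w where w: "corr (ini \<Gamma> e) w"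
    using corr_total labelled_graphD(1)[OF P.graph assms] by blast
  have "coloured D \<Gamma> i (ini \<Gamma> e)" using assms i unfolding coloured_def by blast
  then show ?thesis using Q.edge_exists[OF corr_coloured[OF w] i] w by blast
qed

lemma corr_ter:
  assumes e: "e \<in> edges \<Gamma>" "e' \<in> edges \<Delta>" "corr (ini \<Gamma> e) (ini \<Delta> e')" "lab \<Delta> e' = lab \<Gamma> e"
  shows "corr (ter \<Gamma> e) (ter \<Delta> e')"
proof -
  obtain g where g: "P.at g (ini \<Gamma> e)" "Q.at g (ini \<Delta> e')" using e(3) unfolding corr_def by blast
  show ?thesis
    unfolding corr_def using P.at_path[OF g(1) path_edge[OF P.graph e(1)]]
      Q.at_path[OF g(2) path_edge[OF Q.graph e(2)]] e(4) by auto
qed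

lemma swapped: "precover_pair D \<Delta> w\<^sub>0 \<Gamma> v\<^sub>0"
  by unfold_locales (simp_all add: Lab_eq labels_eq)

theorem pointed_isomorphic: "pointed_isomorphic \<Gamma> v\<^sub>0 \<Delta> w\<^sub>0"
proof -
  interpret S: precover_pair D \<Delta> w\<^sub>0 \<Gamma> v\<^sub>0 by (rule swapped)
  have conv: "S.corr w v \<longleftrightarrow> corr v w" for v w
    unfolding S.corr_def corr_def by blast
  have inj: "corr v w \<Longrightarrow> corr v' w \<Longrightarrow> v = v'" for v v' w
    using S.corr_functional conv by blast
  obtain f where f: "bij_betw f (verts \<Gamma>) (verts \<Delta>)" "\<And>v. v \<in> verts \<Gamma> \<Longrightarrow> corr v (f v)"
  proof (rule rel_bij_betw[of "verts \<Gamma>" "verts \<Delta>" corr])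
    show "\<exists>v\<in>verts \<Gamma>. corr v w" if "w \<in> verts \<Delta>" for w
      using S.corr_total[OF that] conv by blast
  qed (use corr_total corr_functional inj in blast)+
  let ?R = "\<lambda>e e'. e \<in> edges \<Gamma> \<and> e' \<in> edges \<Delta> \<and> corr (ini \<Gamma> e) (ini \<Delta> e') \<and> lab \<Delta> e' = lab \<Gamma> e"
  have "\<exists>e'\<in>edges \<Delta>. ?R e e'" if "e \<in> edges \<Gamma>" for e using corr_edge[OF that] that by blast
  moreover have "\<exists>e\<in>edges \<Gamma>. ?R e e'" if "e' \<in> edges \<Delta>" for e'
    using S.corr_edge[OF that] that conv by metis
  moreover have "e' = e''" if "?R e e'" "?R e e''" for e e' e''
    using that Q.edge_unique[of e' e''] corr_functional by metis
  moreover have "e = e'" if "?R e e''" "?R e' e''" for e e' e''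
    using that P.edge_unique[of e e'] inj by metis
  ultimately obtain k where k: "bij_betw k (edges \<Gamma>) (edges \<Delta>)" "\<And>e. e \<in> edges \<Gamma> \<Longrightarrow> ?R e (k e)"
    using rel_bij_betw[of "edges \<Gamma>" "edges \<Delta>" ?R] by blast
  have "ini \<Delta> (k e) = f (ini \<Gamma> e) \<and> ter \<Delta> (k e) = f (ter \<Gamma> e) \<and> lab \<Delta> (k e) = lab \<Gamma> e"
    if e: "e \<in> edges \<Gamma>" for e
    using k(2)[OF e] corr_ter[of e "k e"] f(2) corr_functional labelled_graphD(1,2)[OF P.graph e] by metis
  then have "graph_isomorphism f k \<Gamma> \<Delta>"
    using f(1) k(1) unfolding graph_isomorphism_def graph_morphism_def bij_betw_def by blast
  moreover have "corr v\<^sub>0 w\<^sub>0" unfolding corr_def using P.at_one Q.at_one by blast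
  then have "f v\<^sub>0 = w\<^sub>0" using f(2)[OF P.base] corr_functional by blast
  ultimately show ?thesis unfolding pointed_isomorphic_def by blast
qed

end

theorem corollary7p4:
  fixes D :: "('x, 'a) amalgam_data"
    and \<Gamma>\<^sub>1 :: "('v, 'e, 'x) lgraph" and v\<^sub>1 :: 'v
    and \<Gamma>\<^sub>2 :: "('w, 'f, 'x) lgraph" and v\<^sub>2 :: 'w
  assumes "amalgam D"
    and "reduced_precover D \<Gamma>\<^sub>1 v\<^sub>1" and "finitely_many_components D \<Gamma>\<^sub>1"
    and "reduced_precover D \<Gamma>\<^sub>2 v\<^sub>2" and "finitely_many_components D \<Gamma>\<^sub>2"
    and "Lab D \<Gamma>\<^sub>1 v\<^sub>1 = Lab D \<Gamma>\<^sub>2 v\<^sub>2"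
  shows "pointed_isomorphic \<Gamma>\<^sub>1 v\<^sub>1 \<Gamma>\<^sub>2 v\<^sub>2"
proof -
  interpret P: precover_at D \<Gamma>\<^sub>1 v\<^sub>1
    using assms by unfold_locales (auto simp: reduced_precover_def)
  interpret Q: precover_at D \<Gamma>\<^sub>2 v\<^sub>2
    using assms by unfold_locales (auto simp: reduced_precover_def)
  note facts = P.subtree_N P.tight_N[OF assms(2)] P.finitely_many_orbits_N[OF assms(3)]
  note facts' = Q.subtree_N Q.tight_N[OF assms(4)] Q.finitely_many_orbits_N[OF assms(5)]
  have "labels_to D \<Gamma>\<^sub>1 v\<^sub>1 = labels_to D \<Gamma>\<^sub>2 v\<^sub>2"
    using P.tight_subtree_le[OF facts(1,2) _ _ _ facts(3)] P.tight_subtree_le[OF _ _ facts]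
      facts'[folded assms(6)] by (meson order_antisym)
  then interpret precover_pair D \<Gamma>\<^sub>1 v\<^sub>1 \<Gamma>\<^sub>2 v\<^sub>2
    using assms(6) by unfold_locales
  show ?thesis by (rule pointed_isomorphic)
qed

end
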